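(* Let $r\ge 1$ be an integer and let $\alpha_1,\dots,\alpha_r>-1$ satisfy $\alpha_i-\alpha_j\notin\mathbb{Z}$ for all $i\ne j$. Let $0<x_{1,rn}<x_{2,rn}<\cdots<x_{rn,rn}$ be the zeros of the multiple Laguerre polynomial of the first kind $L_{n\vec 1}$ with parameters $\vec\alpha=(\alpha_1,\dots,\alpha_r)$ and with multi-index $n\vec 1=(n,n,\dots,n)\in\mathbb{N}^r$. Then for every continuous function $f$ on $[0,c_r/r]$ one has $$\lim_{n\to\infty}\frac{1}{rn}\sum_{k=1}^{rn} f\left(\frac{x_{k,rn}}{rn}\right)=\int_0^{c_r} f(t/r)\,u_r(t)\,dt,\qquad c_r=\frac{(r+1)^{r+1}}{r^r},$$ where the density $u_r$ on $[0,c_r]$ is given by $$u_r(\hat x)=\frac{1}{r\pi}\,\frac{(\sin r\varphi)^{r+1}}{\bigl(\sin(r+1)\varphi\bigr)^r},\qquad 0<\varphi<\frac{\pi}{r+1},$$ where $$\hat x=\frac{\bigl(\sin(r+1)\varphi\bigr)^{r+1}}{\sin\varphi\,\bigl(\sin r\varphi\bigr)^r},\qquad 0<\varphi<\frac{\pi}{r+1}.$$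
   Context: For a multi-index $\vec n=(n_1,\dots,n_r)\in\mathbb{N}^r$ write $|\vec n|=n_1+\cdots+n_r$. The multiple Laguerre polynomial of the first kind $L_{\vec n}$ with parameters $\vec\alpha=(\alpha_1,\dots,\alpha_r)$ is given by the Rodrigues formula $$(-1)^{|\vec n|}e^{-x}L_{\vec n}(x)=\prod_{j=1}^r\left(x^{-\alpha_j}\frac{d^{n_j}}{dx^{n_j}}x^{n_j+\alpha_j}\right)e^{-x},$$ where the product of the differential operators can be taken in any order. When $\alpha_j>-1$ for every $j$ and $\alpha_i-\alpha_j\notin\mathbb{Z}$ for $i\ne j$, it is the unique monic polynomial of degree $|\vec n|$ satisfying $$\int_0^\infty L_{\vec n}(x)\,x^k x^{\alpha_j}e^{-x}\,dx=0,\qquad k=0,1,\dots,n_j-1,\quad j=1,2,\dots,r.$$ The multi-index $n\vec 1$ is $(n,n,\dots,n)$, so $|n\vec 1|=rn$. The map $\varphi\mapsto\hat x$ is strictly decreasing from $(0,\frac{\pi}{r+1})$ onto $(0,c_r)$, so the formula for $u_r(\hat x)$ determines $u_r$ on $(0,c_r)$. The notation $\sin r\varphi$ means $\sin(r\varphi)$ and $\sin(r+1)\varphi$ means $\sin((r+1)\varphi)$.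
   Formalization: Since some scaled zeros may lie outside [0,c_r/r] (e.g. r=1, n=1, α=5), where f is undefined, f is evaluated in the sum through an arbitrary continuous extension of f to [0,∞). *)

theory Defs
  imports "HOL-Analysis.Analysis" "HOL-Computational_Algebra.Polynomial"
begin

text \<open>A multi-index \<open>(n\<^sub>1, \<dots>, n\<^sub>r)\<close> and the parameters \<open>(\<alpha>\<^sub>1, \<dots>, \<alpha>\<^sub>r)\<close> are functions on \<open>nat\<close>,
  of which only the values at \<open>1, \<dots>, r\<close> are used.\<close>

definition laguerre_op :: "real \<Rightarrow> nat \<Rightarrow> (real \<Rightarrow> real) \<Rightarrow> real \<Rightarrow> real" where
  "laguerre_op a m g = (\<lambda>x. x powr (- a) * (deriv ^^ m) (\<lambda>t. t powr (real m + a) * g t) x)"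

text \<open>The product of operators on the right-hand side of the Rodrigues formula, applied to
  \<open>exp (- x)\<close>, with \<open>j = 1\<close> applied first (the operators commute). It is meaningful on \<open>x > 0\<close>.\<close>

primrec rodrigues :: "(nat \<Rightarrow> nat) \<Rightarrow> (nat \<Rightarrow> real) \<Rightarrow> nat \<Rightarrow> real \<Rightarrow> real" where
  "rodrigues n \<alpha> 0 = (\<lambda>x. exp (- x))"
| "rodrigues n \<alpha> (Suc j) = laguerre_op (\<alpha> (Suc j)) (n (Suc j)) (rodrigues n \<alpha> j)"

text \<open>The multiple Laguerre polynomial of the first kind. That the description is proper is shown
  below, in \<open>multiple_laguerre_ex1\<close>.\<close>

definition multiple_laguerre :: "nat \<Rightarrow> (nat \<Rightarrow> nat) \<Rightarrow> (nat \<Rightarrow> real) \<Rightarrow> real poly" where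
  "multiple_laguerre r n \<alpha> = (THE L. \<forall>x>0.
     (-1) ^ (\<Sum>j=1..r. n j) * exp (- x) * poly L x = rodrigues n \<alpha> r x)"

definition c_edge :: "nat \<Rightarrow> real" where
  "c_edge r = real (r + 1) ^ (r + 1) / real r ^ r"

definition x_hat :: "nat \<Rightarrow> real \<Rightarrow> real" where
  "x_hat r \<phi> = sin (real (r + 1) * \<phi>) ^ (r + 1) / (sin \<phi> * sin (real r * \<phi>) ^ r)"

text \<open>The density \<open>u\<^sub>r\<close>: the angle \<open>\<phi>\<close> is recovered from \<open>t = x_hat r \<phi>\<close>, which is possible
  by \<open>x_hat_strict_antimono\<close> below. The values outside \<open>(0, c_edge r)\<close>, in particular at the two
  end points, have no meaning.\<close>

definition u_density :: "nat \<Rightarrow> real \<Rightarrow> real" where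
  "u_density r t =
     (let \<phi> = the_inv_into {0<..<pi / real (r + 1)} (x_hat r) t
      in 1 / (real r * pi) * (sin (real r * \<phi>) ^ (r + 1) / sin (real (r + 1) * \<phi>) ^ r))"


lemma higher_deriv_powr_exp_poly:
  fixes F :: "real \<Rightarrow> real"
  assumes "\<And>x. x > 0 \<Longrightarrow> F x = x powr b * exp (- x) * poly p x"
  shows "\<exists>q. \<forall>x>0. (deriv ^^ m) F x = x powr (b - real m) * exp (- x) * poly q x"
proof (induction m)
  case 0
  then show ?case using assms by auto
next
  case (Suc m)
  then obtain q where q: "\<And>x. x > 0 \<Longrightarrow>
      (deriv ^^ m) F x = x powr (b - real m) * exp (- x) * poly q x" by blast
  define c where "c = b - real m"
  define q' where "q' = smult c q - pCons 0 q + pCons 0 (pderiv q)"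
  have "(deriv ^^ Suc m) F x = x powr (b - real (Suc m)) * exp (- x) * poly q' x"
    if x: "x > 0" for x
  proof -
    have px: "x powr c = x powr (c - 1) * x"
      using x by (simp add: powr_diff)
    have "((\<lambda>x. x powr c * exp (- x) * poly q x) has_field_derivative
        (c * x powr (c - 1) * exp (- x) - x powr c * exp (- x)) * poly q x
          + x powr c * exp (- x) * poly (pderiv q) x) (at x)"
      using x by (auto intro!: derivative_eq_intros poly_DERIV simp: algebra_simps)
    also have "(c * x powr (c - 1) * exp (- x) - x powr c * exp (- x)) * poly q x
          + x powr c * exp (- x) * poly (pderiv q) x = x powr (c - 1) * exp (- x) * poly q' x"
      unfolding px q'_def by (simp add: algebra_simps)
    finally have "((deriv ^^ m) F has_field_derivative x powr (c - 1) * exp (- x) * poly q' x) (at x)"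
      by (rule has_field_derivative_transform_within_open[where S = "{0<..}"])
         (use x q in \<open>auto simp: c_def\<close>)
    moreover have "c - 1 = b - real (Suc m)" by (simp add: c_def)
    ultimately show ?thesis by (simp add: DERIV_imp_deriv)
  qed
  then show ?case by blast
qed

lemma rodrigues_eq_exp_poly: "\<exists>q. \<forall>x>0. rodrigues n \<alpha> r x = exp (- x) * poly q x"
proof (induction r)
  case 0
  show ?case by (rule exI[of _ 1]) simp
next
  case (Suc r)
  then obtain p where p: "\<And>x. x > 0 \<Longrightarrow> rodrigues n \<alpha> r x = exp (- x) * poly p x" by blast
  define a m where "a = \<alpha> (Suc r)" and "m = n (Suc r)"
  have "\<exists>q. \<forall>x>0. (deriv ^^ m) (\<lambda>t. t powr (real m + a) * rodrigues n \<alpha> r t) x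
          = x powr (real m + a - real m) * exp (- x) * poly q x"
    by (rule higher_deriv_powr_exp_poly) (simp add: p)
  then obtain q where q: "\<And>x. x > 0 \<Longrightarrow>
      (deriv ^^ m) (\<lambda>t. t powr (real m + a) * rodrigues n \<alpha> r t) x
          = x powr a * exp (- x) * poly q x" by auto
  have "rodrigues n \<alpha> (Suc r) x = exp (- x) * poly q x" if "x > 0" for x
    using that q[OF that] by (simp add: laguerre_op_def a_def m_def powr_minus)
  then show ?case by blast
qed

lemma multiple_laguerre_ex1:
  "\<exists>!L. \<forall>x>0. (-1) ^ (\<Sum>j=1..r. n j) * exp (- x) * poly L x = rodrigues n \<alpha> r x"
proof -
  obtain q where q: "\<And>x. x > 0 \<Longrightarrow> rodrigues n \<alpha> r x = exp (- x) * poly q x"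
    using rodrigues_eq_exp_poly by blast
  let ?s = "(-1) ^ (\<Sum>j=1..r. n j) :: real"
  have s: "?s * ?s = 1" by (simp flip: power_add)
  show ?thesis
  proof (rule ex1I[of _ "smult ?s q"])
    show "\<forall>x>0. ?s * exp (- x) * poly (smult ?s q) x = rodrigues n \<alpha> r x"
      using s by (auto simp: q)
  next
    fix L assume L: "\<forall>x>0. ?s * exp (- x) * poly L x = rodrigues n \<alpha> r x"
    have *: "poly L x = poly (smult ?s q) x" if "x > 0" for x
    proof -
      have "?s * poly L x = poly q x" using L q[OF that] that by auto
      then have "?s * (?s * poly L x) = ?s * poly q x" by simp
      then show ?thesis using s by (simp flip: mult.assoc)
    qed
    show "L = smult ?s q"
    proof (rule ccontr)
      assume "L \<noteq> smult ?s q"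
      then have "finite {x. poly (L - smult ?s q) x = 0}" by (intro poly_roots_finite) simp
      moreover have "{0::real<..} \<subseteq> {x. poly (L - smult ?s q) x = 0}" using * by auto
      ultimately show False using infinite_Ioi[of "0::real"] finite_subset by blast
    qed
  qed
qed

lemma multiple_laguerre_rodrigues:
  assumes "x > 0"
  shows "(-1) ^ (\<Sum>j=1..r. n j) * exp (- x) * poly (multiple_laguerre r n \<alpha>) x = rodrigues n \<alpha> r x"
  using theI'[OF multiple_laguerre_ex1[where r = r and n = n and \<alpha> = \<alpha>]] assms unfolding multiple_laguerre_def by blast

lemma x_cot_strict_antimono:
  assumes "0 < x" "x < y" "y < pi"
  shows "y * cot y < x * cot x"
proof (rule DERIV_neg_imp_decreasing[OF assms(2)])
  fix z assume z: "x \<le> z" "z \<le> y"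
  have s: "sin z > 0" using z assms by (intro sin_gt_zero) auto
  have "cos z < 1" using cos_monotone_0_pi[of 0 z] z assms by simp
  then have "sin z * cos z < sin z * 1" using s by (intro mult_strict_left_mono)
  also have "\<dots> \<le> z" using sin_x_le_x[of z] z assms by simp
  finally have "sin z * cos z < z" .
  then have "cot z - z / sin z ^ 2 < 0"
    using s by (simp add: cot_def field_simps power2_eq_square)
  moreover have "((\<lambda>x. x * cot x) has_field_derivative cot z - z / sin z ^ 2) (at z)"
    using s by (auto intro!: derivative_eq_intros DERIV_cot[THEN DERIV_chain2] simp: field_simps)
  ultimately show "\<exists>d. ((\<lambda>x. x * cot x) has_real_derivative d) (at z) \<and> d < 0" by blast
qed

lemma x_hat_strict_antimono:
  assumes r: "r \<ge> 1" and "0 < \<phi>" "\<phi> < \<psi>" "\<psi> < pi / real (r + 1)"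
  shows "x_hat r \<psi> < x_hat r \<phi>"
proof -
  define l where "l = (\<lambda>y. real (r + 1) * ln (sin (real (r + 1) * y)) - ln (sin y)
                       - real r * ln (sin (real r * y)))"
  have bnd: "0 < y \<and> y < pi \<and> 0 < real r * y \<and> real r * y < real (r + 1) * y
      \<and> y \<le> real r * y \<and> real (r + 1) * y < pi"
    if "\<phi> \<le> y" "y \<le> \<psi>" for y
  proof -
    have y: "0 < y" "y < pi / real (r + 1)" using that assms by auto
    have "real (r + 1) * y < pi" using y by (simp add: field_simps)
    moreover have "1 * y \<le> real r * y" using r y by (intro mult_right_mono) auto
    moreover have "real (r + 1) * y = real r * y + y" by (simp add: algebra_simps)
    moreover have "real r * y > 0" using y r by simp
    ultimately show ?thesis using y by linarith
  qed
  have pos: "sin y > 0" "sin (real r * y) > 0" "sin (real (r + 1) * y) > 0"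
    if "\<phi> \<le> y" "y \<le> \<psi>" for y
    by (rule sin_gt_zero; use bnd[OF that] in linarith)+
  have "l \<psi> < l \<phi>"
  proof (rule DERIV_neg_imp_decreasing[OF assms(3)])
    fix y assume y: "\<phi> \<le> y" "y \<le> \<psi>"
    note b = bnd[OF y] and p = pos[OF y]
    define d where "d = real (r + 1) * (real (r + 1) * cot (real (r + 1) * y)) - cot y
                        - real r * (real r * cot (real r * y))"
    let ?h = "\<lambda>z. z * cot z"
    have h1: "?h (real (r + 1) * y) < ?h y"
      using b r by (intro x_cot_strict_antimono) auto
    have h2: "?h (real (r + 1) * y) < ?h (real r * y)"
      using b by (intro x_cot_strict_antimono) auto
    have h3: "real r * ?h (real (r + 1) * y) < real r * ?h (real r * y)"
      using h2 r by (intro mult_strict_left_mono) auto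
    have eq: "y * d = real (r + 1) * ?h (real (r + 1) * y) - ?h y - real r * ?h (real r * y)"
      unfolding d_def by (simp only: algebra_simps)
    have split: "real (r + 1) * w = real r * w + w" for w by (simp add: algebra_simps)
    have "y * d < 0"
      using h1 h3 unfolding eq split[of "?h (real (r + 1) * y)"] by linarith
    then have "d < 0" using b by (simp add: mult_less_0_iff)
    moreover have "(l has_real_derivative d) (at y)"
      unfolding l_def d_def using p
      by (auto intro!: derivative_eq_intros simp: cot_def mult_ac)
    ultimately show "\<exists>d. (l has_real_derivative d) (at y) \<and> d < 0" by blast
  qed
  moreover have "x_hat r y = exp (l y)" if "\<phi> \<le> y" "y \<le> \<psi>" for y
  proof -
    have e: "exp (real k * ln z) = z ^ k" if "z > 0" for z :: real and k
      using that by (simp add: exp_of_nat_mult)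
    show ?thesis
      using pos[OF that] unfolding l_def x_hat_def exp_diff
      by (simp only: e exp_ln divide_divide_eq_left)
  qed
  ultimately show ?thesis using assms by simp
qed

lemma u_density_x_hat:
  assumes "r \<ge> 1" "0 < \<phi>" "\<phi> < pi / real (r + 1)"
  shows "u_density r (x_hat r \<phi>)
    = 1 / (real r * pi) * (sin (real r * \<phi>) ^ (r + 1) / sin (real (r + 1) * \<phi>) ^ r)"
proof -
  have "inj_on (x_hat r) {0<..<pi / real (r + 1)}"
  proof (rule inj_onI)
    fix a b assume "a \<in> {0<..<pi / real (r + 1)}" "b \<in> {0<..<pi / real (r + 1)}"
      and eq: "x_hat r a = x_hat r b"
    then show "a = b"
      using x_hat_strict_antimono[OF assms(1), of a b] x_hat_strict_antimono[OF assms(1), of b a]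
      by (cases a b rule: linorder_cases) auto
  qed
  then have "the_inv_into {0<..<pi / real (r + 1)} (x_hat r) (x_hat r \<phi>) = \<phi>"
    using assms by (intro the_inv_into_f_f) auto
  then show ?thesis by (simp add: u_density_def)
qed

end

theory Submission
  imports Defs "HOL-Computational_Algebra.Formal_Power_Series"
begin

text \<open>
  The zeros are studied through their power sums, which can be read off from the linear differential
  equation of the polynomial.

  Write \<open>\<theta> = x d/dx\<close>. Conjugating \<open>\<theta> + \<beta>\<close> with \<open>exp (- x)\<close> gives the operator
  \<open>T\<^sub>\<beta> p = \<beta> p + x p' - x p\<close> on polynomials, and the Rodrigues formula says that, up to sign, the
  multiple Laguerre polynomial is \<open>P = \<Prod>\<^sub>j \<Prod>\<^sub>m T\<^bsub>\<alpha>\<^sub>j + m\<^esub> 1\<close> with \<open>m = 1, \<dots>, n\<close>. These operators commute,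
  \<open>T\<^sub>0 1 = - x\<close>, and \<open>T\<^sub>\<beta> (x q) = x T\<^bsub>\<beta> + 1\<^esub> q\<close>. Hence
  \<open>T\<^sub>0 \<Prod>\<^sub>j T\<^bsub>\<alpha>\<^sub>j\<^esub> P = - x \<Prod>\<^sub>j T\<^bsub>\<alpha>\<^sub>j + n + 1\<^esub> P\<close>, which is the differential equation of order \<open>r + 1\<close>
  (\<open>laguerre_identity\<close>).

  Now divide by \<open>P\<close>, scale the zeros by \<open>1/n\<close> and expand in powers of \<open>y = n/x\<close>. Up to terms of order
  \<open>1/n\<close>, the operator \<open>T\<^sub>\<beta>\<close> acts as multiplication by \<open>- n (E\<^sub>n - (\<beta>/n) y) / y\<close>, where
  \<open>E\<^sub>n = 1 - y \<Sum>\<^sub>m (1/n \<Sum>\<^sub>k (x\<^sub>k/n)\<^sup>m) y\<^sup>m\<close> collects the moments of the zeros. So the differential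
  equation degenerates into the algebraic equation \<open>E\<^sup>r\<^sup>+\<^sup>1 = (E - y)\<^sup>r\<close>, coefficient by coefficient
  (\<open>rev_steps_asymptotic\<close>). That equation has only one solution with constant term \<open>1\<close>, the
  solution depends continuously on the error (\<open>algebraic_equation_stable\<close>), and by Lagrange
  inversion the limit moments are \<open>((r + 1) m choose m) / (m + 1)\<close>.

  The density has the same moments. With \<open>s(\<phi>) = sin ((r + 1) \<phi>) / sin \<phi> \<cdot> exp (- \<i> r \<phi>)\<close> one has
  \<open>x_hat = s\<^sup>r\<^sup>+\<^sup>1 / (s - 1)\<^sup>r\<close>, and \<open>x_hat \<cdot> u\<close> is a multiple of the imaginary part of \<open>s\<close>. After
  the substitution \<open>t = x_hat r \<phi>\<close>, the moment integral is the imaginary part of the integral along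
  this curve of a Laurent polynomial in \<open>s - 1\<close>; both end points are real, so only the residue term,
  whose primitive is a logarithm, contributes (\<open>curve_moment_integral\<close>).

  Weierstrass approximation passes from moments to continuous functions. This needs all scaled zeros
  in one bounded interval, also the exceptional ones outside the support of the limit; that
  bound is \<open>zeros_linear_bound\<close>, proved by moving a barrier to the right by \<open>2\<close> each time one of the
  \<open>r n\<close> operators is applied.
\<close>

unbundle no vec_syntax
unbundle fps_syntax

section \<open>The Rodrigues formula as a product of commuting operators\<close>

text \<open>This is \<open>exp x \<cdot> (x d/dx + \<beta>) \<cdot> exp (- x)\<close> acting on polynomials, the operator \<open>T\<^sub>\<beta>\<close> of the
  introduction.\<close>

definition lag_step :: "real \<Rightarrow> real poly \<Rightarrow> real poly" where
  "lag_step \<beta> p = smult \<beta> p - pCons 0 p + pCons 0 (pderiv p)"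

lemma lag_step_commute: "lag_step a (lag_step b p) = lag_step b (lag_step a p)"
  by (rule poly_eqI) (simp add: lag_step_def coeff_pCons coeff_pderiv algebra_simps split: nat.split)

text \<open>The operator \<open>x d/dx\<close> satisfies \<open>\<theta> x = x (\<theta> + 1)\<close>, so pulling out a factor \<open>x\<close> shifts the
  parameter by one.\<close>

lemma lag_step_pCons: "lag_step b (pCons 0 q) = pCons 0 (lag_step (b + 1) q)"
  by (rule poly_eqI) (simp add: lag_step_def coeff_pCons coeff_pderiv algebra_simps split: nat.split)

lemma fold_lag_step_pCons:
  "fold lag_step bs (pCons 0 q) = pCons 0 (fold lag_step (map (\<lambda>b. b + 1) bs) q)"
  by (induction bs arbitrary: q) (simp_all add: lag_step_pCons)

lemma lag_step_uminus: "lag_step b (- q) = - lag_step b q"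
  by (rule poly_eqI) (simp add: lag_step_def coeff_pCons coeff_pderiv algebra_simps split: nat.split)

lemma fold_lag_step_uminus: "fold lag_step bs (- q) = - fold lag_step bs q"
  by (induction bs arbitrary: q) (simp_all add: lag_step_uminus)

lemma fold_lag_step_mset:
  "mset bs = mset cs \<Longrightarrow> fold lag_step bs p = fold lag_step cs p"
  by (rule fun_cong, rule fold_multiset_equiv) (auto simp: lag_step_commute)

lemma coeff_lag_step:
  "coeff (lag_step b p) i = (b + real i) * coeff p i - (if i = 0 then 0 else coeff p (i - 1))"
  by (cases i) (simp_all add: lag_step_def coeff_pCons coeff_pderiv algebra_simps)

lemma degree_lag_step: "degree p \<le> N \<Longrightarrow> degree (lag_step b p) \<le> Suc N"
  by (rule degree_le) (auto simp: coeff_lag_step coeff_eq_0)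

lemma degree_fold_lag_step:
  "degree p \<le> N \<Longrightarrow> degree (fold lag_step bs p) \<le> N + length bs"
proof (induction bs arbitrary: p N)
  case (Cons b bs)
  show ?case using Cons.IH[of "lag_step b p" "Suc N"] degree_lag_step[OF Cons.prems] by simp
qed simp

text \<open>The parameters are listed in the order in which differentiation in the Rodrigues formula
  produces them: the \<open>i\<close>-th derivative acts on the exponent lowered to \<open>n\<^sub>j + \<alpha>\<^sub>j - i\<close>.\<close>

definition laguerre_shifts :: "(nat \<Rightarrow> nat) \<Rightarrow> (nat \<Rightarrow> real) \<Rightarrow> nat \<Rightarrow> real list" where
  "laguerre_shifts n \<alpha> r =
     concat (map (\<lambda>j. map (\<lambda>i. \<alpha> j + real (n j) - real i) [0..<n j]) [1..<Suc r])"

lemma higher_deriv_powr_exp_fold: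
  fixes F :: "real \<Rightarrow> real"
  assumes F: "\<And>x. x > 0 \<Longrightarrow> F x = x powr b * exp (- x) * poly p x"
  shows "x > 0 \<Longrightarrow> (deriv ^^ m) F x =
    x powr (b - real m) * exp (- x) * poly (fold lag_step (map (\<lambda>i. b - real i) [0..<m]) p) x"
proof (induction m arbitrary: x)
  case 0
  then show ?case using F by simp
next
  case (Suc m)
  define c where "c = b - real m"
  define q where "q = fold lag_step (map (\<lambda>i. b - real i) [0..<m]) p"
  have px: "x powr c = x powr (c - 1) * x"
    using Suc.prems by (simp add: powr_diff)
  have "((\<lambda>x. x powr c * exp (- x) * poly q x) has_field_derivative
      (c * x powr (c - 1) * exp (- x) - x powr c * exp (- x)) * poly q x
        + x powr c * exp (- x) * poly (pderiv q) x) (at x)"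
    using Suc.prems by (auto intro!: derivative_eq_intros poly_DERIV simp: algebra_simps)
  also have "(c * x powr (c - 1) * exp (- x) - x powr c * exp (- x)) * poly q x
        + x powr c * exp (- x) * poly (pderiv q) x
      = x powr (c - 1) * exp (- x) * poly (lag_step c q) x"
    unfolding px lag_step_def by (simp add: algebra_simps)
  finally have "((deriv ^^ m) F has_field_derivative
      x powr (c - 1) * exp (- x) * poly (lag_step c q) x) (at x)"
    by (rule has_field_derivative_transform_within_open[where S = "{0<..}"])
       (use Suc in \<open>auto simp: c_def q_def\<close>)
  moreover have "c - 1 = b - real (Suc m)" by (simp add: c_def)
  ultimately show ?case by (simp add: DERIV_imp_deriv c_def q_def diff_diff_eq add.commute)
qed

lemma rodrigues_eq:
  "x > 0 \<Longrightarrow> rodrigues n \<alpha> r x = exp (- x) * poly (fold lag_step (laguerre_shifts n \<alpha> r) 1) x"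
proof (induction r arbitrary: x)
  case 0
  then show ?case by (simp add: laguerre_shifts_def)
next
  case (Suc r)
  let ?a = "\<alpha> (Suc r)" and ?m = "n (Suc r)"
  let ?p = "fold lag_step (laguerre_shifts n \<alpha> r) 1"
  have "(deriv ^^ ?m) (\<lambda>t. t powr (real ?m + ?a) * rodrigues n \<alpha> r t) x =
      x powr (real ?m + ?a - real ?m) * exp (- x) *
      poly (fold lag_step (map (\<lambda>i. (real ?m + ?a) - real i) [0..<?m]) ?p) x"
    by (rule higher_deriv_powr_exp_fold) (use Suc in auto)
  moreover have "laguerre_shifts n \<alpha> (Suc r) =
      laguerre_shifts n \<alpha> r @ map (\<lambda>i. (real ?m + ?a) - real i) [0..<?m]"
    by (simp add: laguerre_shifts_def add.commute)
  ultimately show ?case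
    using Suc.prems by (simp add: laguerre_op_def powr_minus)
qed

lemma multiple_laguerre_eq:
  "multiple_laguerre r n \<alpha> =
     smult ((-1) ^ (\<Sum>j=1..r. n j)) (fold lag_step (laguerre_shifts n \<alpha> r) 1)"
  unfolding multiple_laguerre_def
  by (rule the1_equality[OF multiple_laguerre_ex1])
     (simp add: rodrigues_eq flip: mult.assoc power_add)

lemma length_laguerre_shifts: "length (laguerre_shifts n \<alpha> r) = (\<Sum>j=1..r. n j)"
  by (induction r) (simp_all add: laguerre_shifts_def)

text \<open>The differential equation. Prefixing the parameter \<open>0\<close> to the list multiplies by \<open>- x\<close> and
  shifts all other parameters by one. The shifted block \<open>\<alpha>\<^sub>j + 1, \<dots>, \<alpha>\<^sub>j + n + 1\<close> arises from
  the unshifted one \<open>\<alpha>\<^sub>j + 1, \<dots>, \<alpha>\<^sub>j + n\<close> by adding the single parameter \<open>\<alpha>\<^sub>j + n + 1\<close>, whence the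
  right-hand side.\<close>

lemma laguerre_identity:
  fixes r n :: nat and \<alpha> :: "nat \<Rightarrow> real"
  defines "P \<equiv> fold lag_step (laguerre_shifts (\<lambda>j. n) \<alpha> r) 1"
  shows "fold lag_step (map \<alpha> [1..<Suc r] @ [0]) P =
         - pCons 0 (fold lag_step (map (\<lambda>j. \<alpha> j + real n + 1) [1..<Suc r]) P)"
proof -
  let ?s = "laguerre_shifts (\<lambda>j. n) \<alpha>"
  have blk: "mset (map (\<lambda>i. a + real n - real i + 1) [0..<n]) + {#a + 1#} =
             mset (map (\<lambda>i. a + real n - real i) [0..<n]) + {#a + real n + 1#}" for a :: real
  proof -
    have "mset (map (\<lambda>i. a + real n - real i + 1) [0..<Suc n]) =
          mset (map (\<lambda>i. a + real n - real i + 1) [0..<n]) + {#a + 1#}"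
      by simp
    moreover have "map (\<lambda>i. a + real n - real i + 1) [0..<Suc n] =
        (a + real n + 1) # map (\<lambda>i. a + real n - real i) [0..<n]"
      by (simp add: upt_conv_Cons map_Suc_upt[symmetric] o_def del: upt_Suc)
    ultimately show ?thesis by (metis add_mset_add_single mset.simps(2))
  qed
  have ms: "mset (map (\<lambda>b. b + 1) (?s r @ map \<alpha> [1..<Suc r])) =
            mset (?s r @ map (\<lambda>j. \<alpha> j + real n + 1) [1..<Suc r])"
  proof (induction r)
    case (Suc r)
    have "[1..<Suc (Suc r)] = [1..<Suc r] @ [Suc r]" by simp
    moreover have comb: "X + X' + (Y + Y') = Z + Z' + (W + W')"
      if "X + Y = Z + W" "X' + Y' = Z' + W'" for X Y Z W X' Y' Z' W' :: "real multiset"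
      using arg_cong2[OF that, of "(+)"] by (simp add: ac_simps)
    ultimately show ?case using comb[OF Suc[unfolded map_append mset_append] blk[of "\<alpha> (Suc r)"]]
      by (simp add: laguerre_shifts_def o_def add.assoc del: upt_Suc)
  qed (simp add: laguerre_shifts_def)
  have "fold lag_step (map \<alpha> [1..<Suc r] @ [0]) P = fold lag_step (?s r @ map \<alpha> [1..<Suc r] @ [0]) 1"
    by (simp add: P_def)
  also have "\<dots> = fold lag_step (0 # ?s r @ map \<alpha> [1..<Suc r]) 1"
    by (rule fold_lag_step_mset) simp
  also have "lag_step 0 1 = - pCons 0 1"
    by (simp add: lag_step_def)
  then have "fold lag_step (0 # ?s r @ map \<alpha> [1..<Suc r]) 1 =
      - pCons 0 (fold lag_step (map (\<lambda>b. b + 1) (?s r @ map \<alpha> [1..<Suc r])) 1)"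
    by (simp only: fold_simps fold_lag_step_uminus fold_lag_step_pCons)
  also have "fold lag_step (map (\<lambda>b. b + 1) (?s r @ map \<alpha> [1..<Suc r])) 1 =
      fold lag_step (?s r @ map (\<lambda>j. \<alpha> j + real n + 1) [1..<Suc r]) 1"
    by (rule fold_lag_step_mset[OF ms])
  finally show ?thesis by (simp add: P_def)
qed


section \<open>Reversed polynomials\<close>

text \<open>This is \<open>(- 1)\<^sup>N y\<^sup>N p(1/y)\<close> with \<open>h y\<close> in place of \<open>y\<close>. The sign absorbs the one in the leading
  coefficient of \<open>T\<^sub>\<beta> p\<close>, so that the reversed Laguerre polynomials have constant term \<open>1\<close>, and
  the scale \<open>h\<close> turns the zeros \<open>x\<^sub>k\<close> into \<open>h x\<^sub>k\<close>.\<close>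

definition rev_fps :: "real \<Rightarrow> nat \<Rightarrow> real poly \<Rightarrow> real fps" where
  "rev_fps h N p = Abs_fps (\<lambda>i. if i \<le> N then (-1) ^ N * h ^ i * coeff p (N - i) else 0)"

text \<open>The operator \<open>T\<^sub>\<beta>\<close> seen through the reversal; the degree \<open>N\<close> of the polynomial and \<open>\<beta>\<close> enter
  only through \<open>c = N + \<beta>\<close>, as \<open>\<theta>\<close> acts on \<open>x\<^sup>N R(h/x)\<close>.\<close>

definition rev_step :: "real \<Rightarrow> real \<Rightarrow> real fps \<Rightarrow> real fps" where
  "rev_step h c R = R - fps_const (h * c) * fps_X * R + fps_const h * fps_X ^ 2 * fps_deriv R"

lemma rev_fps_lag_step:
  assumes "degree p \<le> N"
  shows "rev_fps h (Suc N) (lag_step b p) = rev_step h (real N + b) (rev_fps h N p)"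
proof (rule fps_ext)
  fix i
  let ?R = "rev_fps h N p"
  have X2: "(fps_X ^ 2 * fps_deriv ?R) $ Suc k = real k * ?R $ k" for k
    by (cases k) (simp_all add: fps_X_power_mult_nth)
  show "rev_fps h (Suc N) (lag_step b p) $ i = rev_step h (real N + b) ?R $ i"
  proof (cases i)
    case 0
    then show ?thesis using assms
      by (simp add: rev_step_def rev_fps_def coeff_lag_step mult.assoc coeff_eq_0 fps_X_power_mult_nth)
  next
    case (Suc k)
    have R: "rev_step h (real N + b) ?R $ i = ?R $ Suc k - h * (real N + b - real k) * ?R $ k"
      unfolding Suc rev_step_def
      by (simp add: mult.assoc X2) (simp add: algebra_simps)
    show ?thesis
    proof (cases "k \<le> N")
      case True
      then obtain m where N: "N = k + m" using le_Suc_ex by blast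
      show ?thesis unfolding R
        by (cases m) (simp_all add: Suc N rev_fps_def coeff_lag_step algebra_simps)
    next
      case False
      then show ?thesis unfolding R by (simp add: Suc rev_fps_def)
    qed
  qed
qed

lemma rev_fps_uminus_pCons: "rev_fps h (Suc N) (- pCons 0 q) = rev_fps h N q"
  by (rule fps_ext) (auto simp: rev_fps_def Suc_diff_le le_Suc_eq)

primrec rev_steps :: "real \<Rightarrow> nat \<Rightarrow> real list \<Rightarrow> real fps \<Rightarrow> real fps" where
  "rev_steps h N [] R = R"
| "rev_steps h N (b # bs) R = rev_steps h (Suc N) bs (rev_step h (real N + b) R)"

lemma rev_fps_fold_lag_step:
  "degree p \<le> N \<Longrightarrow>
   rev_fps h (N + length bs) (fold lag_step bs p) = rev_steps h N bs (rev_fps h N p)"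
proof (induction bs arbitrary: p N)
  case (Cons b bs)
  show ?case
    using Cons.IH[of "lag_step b p" "Suc N"] degree_lag_step[OF Cons.prems]
    by (simp add: rev_fps_lag_step[OF Cons.prems])
qed simp

lemma multiple_laguerre_monic:
  "degree (multiple_laguerre r n \<alpha>) \<le> (\<Sum>j=1..r. n j)"
  "coeff (multiple_laguerre r n \<alpha>) (\<Sum>j=1..r. n j) = 1"
proof -
  let ?N = "\<Sum>j=1..r. n j" and ?bs = "laguerre_shifts n \<alpha> r"
  have d: "degree (fold lag_step ?bs 1) \<le> ?N"
    using degree_fold_lag_step[of 1 0 ?bs] by (simp add: length_laguerre_shifts)
  then show "degree (multiple_laguerre r n \<alpha>) \<le> ?N"
    unfolding multiple_laguerre_eq by (metis degree_smult_le order_trans)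
  have "coeff (fold lag_step bs p) (N + length bs) = (-1) ^ length bs * coeff p N"
    if "degree p \<le> N" for bs p N
    using that
  proof (induction bs arbitrary: p N)
    case (Cons b bs)
    then show ?case using Cons.IH[of "lag_step b p" "Suc N"] degree_lag_step[OF Cons.prems, of b]
      by (simp add: coeff_lag_step coeff_eq_0)
  qed simp
  from this[of 1 0 ?bs] have "coeff (fold lag_step ?bs 1) ?N = (-1) ^ ?N"
    by (simp add: length_laguerre_shifts)
  then show "coeff (multiple_laguerre r n \<alpha>) ?N = 1"
    unfolding multiple_laguerre_eq by (simp flip: power_add)
qed

lemma degree_prod_linear: "degree (\<Prod>k\<in>A. [:- x k, 1 :: real:]) = card A"
  by (subst degree_prod_sum_eq) auto

lemma coeff_prod_linear: "coeff (\<Prod>k\<in>A. [:- x k, 1 :: real:]) (card A) = 1"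
  using lead_coeff_prod[of "\<lambda>k. [:- x k, 1 :: real:]" A] by (simp add: degree_prod_linear)

lemma rev_fps_prod_linear:
  assumes "finite A"
  shows "rev_fps h (card A) (smult ((-1) ^ card A) (\<Prod>k\<in>A. [:- x k, 1:]))
       = (\<Prod>k\<in>A. 1 - fps_const (h * x k) * fps_X)"
  using assms
proof (induction A rule: finite_induct)
  case empty
  show ?case by (rule fps_ext) (simp add: rev_fps_def)
next
  case (insert a A)
  let ?p = "\<Prod>k\<in>A. [:- x k, 1:]"
  have s: "(-1) ^ N * (h ^ i * ((-1) ^ N * c)) = h ^ i * (c::real)" for N i c
    by (simp add: mult.left_commute flip: power_add mult.assoc)
  have IH: "(\<Prod>k\<in>A. 1 - fps_const (h * x k) * fps_X) $ i = (if i \<le> card A then h ^ i * coeff ?p (card A - i) else 0)" for i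
    using insert.IH[symmetric] by (simp add: rev_fps_def mult.assoc s)
  have d: "coeff ?p i = 0" if "i > card A" for i
    using degree_prod_linear[of x A] that by (intro coeff_eq_0) linarith
  show ?case
  proof (rule fps_ext)
    fix i
    have "rev_fps h (card (insert a A)) (smult ((-1) ^ card (insert a A)) (\<Prod>k\<in>insert a A. [:- x k, 1:])) $ i
      = (if i \<le> Suc (card A) then h ^ i * coeff ([:- x a, 1:] * ?p) (Suc (card A) - i) else 0)"
      using insert.hyps by (simp add: rev_fps_def mult.assoc s del: power_Suc mult_pCons_left)
    also have "\<dots> = (\<Prod>k\<in>insert a A. 1 - fps_const (h * x k) * fps_X) $ i"
    proof -
      have "(\<Prod>k\<in>insert a A. 1 - fps_const (h * x k) * fps_X) $ i =
         (\<Prod>k\<in>A. 1 - fps_const (h * x k) * fps_X) $ i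
         - h * x a * (if i = 0 then 0 else (\<Prod>k\<in>A. 1 - fps_const (h * x k) * fps_X) $ (i - 1))"
        using insert.hyps by (simp add: algebra_simps)
      also have "\<dots> = (if i \<le> Suc (card A) then h ^ i * coeff ([:- x a, 1:] * ?p) (Suc (card A) - i) else 0)"
      proof (cases i)
        case 0
        then show ?thesis by (simp add: IH d)
      next
        case (Suc k)
        show ?thesis
        proof (cases "k \<le> card A")
          case True
          then obtain m where m: "card A = k + m" using le_Suc_ex by blast
          show ?thesis unfolding IH Suc m by (cases m) (simp_all add: algebra_simps)
        qed (simp add: IH Suc)
      qed
      finally show ?thesis by simp
    qed
    finally show "rev_fps h (card (insert a A)) (smult ((-1) ^ card (insert a A)) (\<Prod>k\<in>insert a A. [:- x k, 1:])) $ i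
      = (\<Prod>k\<in>insert a A. 1 - fps_const (h * x k) * fps_X) $ i" .
  qed
qed

text \<open>The logarithmic derivative is the generating function of the power sums.\<close>

lemma log_deriv_prod_linear:
  assumes "finite A"
  shows "fps_deriv (\<Prod>k\<in>A. 1 - fps_const (a k) * fps_X) * inverse (\<Prod>k\<in>A. 1 - fps_const (a k) * fps_X)
     = Abs_fps (\<lambda>m. - (\<Sum>k\<in>A. a k ^ Suc m :: real))"
  using assms
proof (induction A rule: finite_induct)
  case empty
  show ?case by (rule fps_ext) simp
next
  case (insert b A)
  let ?R = "\<Prod>k\<in>A. 1 - fps_const (a k) * fps_X"
  let ?l = "1 - fps_const (a b) * fps_X"
  have R0: "?R $ 0 = 1" by (induction A rule: infinite_finite_induct) simp_all
  have i: "?l * inverse ?l = 1" "?R * inverse ?R = 1" using R0 by (auto intro!: inverse_mult_eq_1')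
  have "fps_deriv (p * q) * inverse (p * q)
      = fps_deriv p * inverse p * (q * inverse q) + (p * inverse p) * (fps_deriv q * inverse q)" for p q :: "real fps"
    by (simp add: fps_inverse_mult algebra_simps)
  then have "fps_deriv (?l * ?R) * inverse (?l * ?R)
      = fps_deriv ?l * inverse ?l * (?R * inverse ?R) + (?l * inverse ?l) * (fps_deriv ?R * inverse ?R)" .
  also have "\<dots> = fps_deriv ?l * inverse ?l + Abs_fps (\<lambda>m. - (\<Sum>k\<in>A. a k ^ Suc m))"
    by (simp only: i insert.IH mult_1_right mult_1_left)
  also have "fps_deriv ?l * inverse ?l = Abs_fps (\<lambda>m. - (a b ^ Suc m))"
    using one_minus_const_fps_X_neg_power'[of 1 "a b"] by (intro fps_ext) simp
  also have "\<dots> + Abs_fps (\<lambda>m. - (\<Sum>k\<in>A. a k ^ Suc m)) = Abs_fps (\<lambda>m. - (\<Sum>k\<in>insert b A. a k ^ Suc m))"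
    using insert.hyps by (intro fps_ext) simp
  finally show ?case using insert.hyps by simp
qed


section \<open>Power series with bounded coefficients\<close>

text \<open>A small calculus for passing to the limit coefficient by coefficient: sequences of series with
  bounded coefficients form a ring, closed under differentiation and under inversion of series with
  constant term \<open>1\<close>, and the sequences tending to \<open>0\<close> form an ideal in it.\<close>

definition coeff_bdd :: "(nat \<Rightarrow> real fps) \<Rightarrow> bool" where
  "coeff_bdd A \<longleftrightarrow> (\<forall>k. Bseq (\<lambda>n. A n $ k))"

definition coeff_null :: "(nat \<Rightarrow> real fps) \<Rightarrow> bool" where
  "coeff_null A \<longleftrightarrow> (\<forall>k. (\<lambda>n. A n $ k) \<longlonglongrightarrow> 0)"

lemma coeff_null_imp_bdd: "coeff_null A \<Longrightarrow> coeff_bdd A"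
  unfolding coeff_null_def coeff_bdd_def
  by (blast intro: convergent_imp_Bseq convergentI)

lemma Bseq_plus: "Bseq f \<Longrightarrow> Bseq g \<Longrightarrow> Bseq (\<lambda>n. f n + g n :: real)"
proof -
  assume "Bseq f" "Bseq g"
  then obtain K L where "\<And>n. norm (f n) \<le> K" "\<And>n. norm (g n) \<le> L" by (metis BseqE)
  then have "norm (f n + g n) \<le> K + L" for n by (rule norm_triangle_mono)
  then show ?thesis by (rule BseqI')
qed

lemma Bseq_sum: "finite I \<Longrightarrow> (\<And>i. i \<in> I \<Longrightarrow> Bseq (\<lambda>n. f i n)) \<Longrightarrow> Bseq (\<lambda>n. \<Sum>i\<in>I. f i n :: real)"
  by (induction I rule: finite_induct) (auto intro!: Bseq_plus)

lemma coeff_bdd_const: "coeff_bdd (\<lambda>n. c)"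
  by (simp add: coeff_bdd_def)

lemma coeff_bdd_add: "coeff_bdd A \<Longrightarrow> coeff_bdd B \<Longrightarrow> coeff_bdd (\<lambda>n. A n + B n)"
  by (simp add: coeff_bdd_def Bseq_plus)

lemma coeff_bdd_uminus: "coeff_bdd A \<Longrightarrow> coeff_bdd (\<lambda>n. - A n)"
  by (simp add: coeff_bdd_def Bseq_minus_iff)

lemma coeff_bdd_diff: "coeff_bdd A \<Longrightarrow> coeff_bdd B \<Longrightarrow> coeff_bdd (\<lambda>n. A n - B n)"
  using coeff_bdd_add[OF _ coeff_bdd_uminus] by fastforce

lemma coeff_bdd_mult: "coeff_bdd A \<Longrightarrow> coeff_bdd B \<Longrightarrow> coeff_bdd (\<lambda>n. A n * B n)"
  unfolding coeff_bdd_def fps_mult_nth by (intro allI Bseq_sum Bseq_mult) auto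

lemma coeff_bdd_power: "coeff_bdd A \<Longrightarrow> coeff_bdd (\<lambda>n. A n ^ k)"
  by (induction k) (simp_all add: coeff_bdd_const coeff_bdd_mult)

lemma coeff_bdd_sum:
  "finite I \<Longrightarrow> (\<And>i. i \<in> I \<Longrightarrow> coeff_bdd (A i)) \<Longrightarrow> coeff_bdd (\<lambda>n. \<Sum>i\<in>I. A i n)"
  by (induction I rule: finite_induct) (simp_all add: coeff_bdd_const coeff_bdd_add)

lemma coeff_bdd_deriv: "coeff_bdd A \<Longrightarrow> coeff_bdd (\<lambda>n. fps_deriv (A n))"
  unfolding coeff_bdd_def by (auto intro!: Bseq_mult)

lemma coeff_bdd_inverse:
  assumes A: "coeff_bdd A" and A0: "\<And>n. A n $ 0 = 1"
  shows "coeff_bdd (\<lambda>n. inverse (A n))"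
  unfolding coeff_bdd_def
proof
  fix k
  show "Bseq (\<lambda>n. inverse (A n) $ k)"
  proof (induction k rule: less_induct)
    case (less k)
    show ?case
    proof (cases "k = 0")
      case True
      then show ?thesis by (simp add: A0)
    next
      case False
      have "inverse (A n) $ k = - (\<Sum>i=1..k. A n $ i * inverse (A n) $ (k - i))" for n
      proof -
        have "(\<Sum>i=0..k. A n $ i * inverse (A n) $ (k - i)) = (A n * inverse (A n)) $ k"
          by (simp add: fps_mult_nth)
        also have "\<dots> = 0" using False by (simp add: A0 inverse_mult_eq_1')
        finally show ?thesis by (simp add: sum.atLeast_Suc_atMost A0)
      qed
      moreover have "Bseq (\<lambda>n. - (\<Sum>i=1..k. A n $ i * inverse (A n) $ (k - i)))"
        unfolding Bseq_minus_iff
        by (intro Bseq_sum Bseq_mult less) (use A in \<open>auto simp: coeff_bdd_def\<close>)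
      ultimately show ?thesis by simp
    qed
  qed
qed

lemma coeff_null_0: "coeff_null (\<lambda>n. 0)"
  by (simp add: coeff_null_def)

lemma coeff_null_add: "coeff_null A \<Longrightarrow> coeff_null B \<Longrightarrow> coeff_null (\<lambda>n. A n + B n)"
  unfolding coeff_null_def by (auto intro: tendsto_add_zero)

lemma coeff_null_uminus: "coeff_null A \<Longrightarrow> coeff_null (\<lambda>n. - A n)"
  unfolding coeff_null_def using tendsto_minus by fastforce

lemma coeff_null_diff: "coeff_null A \<Longrightarrow> coeff_null B \<Longrightarrow> coeff_null (\<lambda>n. A n - B n)"
  using coeff_null_add[OF _ coeff_null_uminus] by fastforce

lemma tendsto_0_mult_Bseq:
  fixes f g :: "nat \<Rightarrow> real"
  assumes f: "f \<longlonglongrightarrow> 0" and g: "Bseq g"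
  shows "(\<lambda>n. f n * g n) \<longlonglongrightarrow> 0"
proof -
  obtain K where K: "\<And>n. norm (g n) \<le> K" using g by (metis BseqE)
  show ?thesis
  proof (rule Lim_null_comparison)
    show "\<forall>\<^sub>F n in sequentially. norm (f n * g n) \<le> norm (f n) * K"
      using K by (intro always_eventually allI) (simp add: abs_mult mult_left_mono)
    show "(\<lambda>n. norm (f n) * K) \<longlonglongrightarrow> 0"
      using tendsto_mult[OF tendsto_norm[OF f] tendsto_const[of K]] by simp
  qed
qed

lemma coeff_null_mult: "coeff_null A \<Longrightarrow> coeff_bdd B \<Longrightarrow> coeff_null (\<lambda>n. A n * B n)"
  unfolding coeff_null_def coeff_bdd_def fps_mult_nth
  by (intro allI tendsto_null_sum tendsto_0_mult_Bseq) auto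

lemma coeff_null_const_mult:
  "c \<longlonglongrightarrow> 0 \<Longrightarrow> coeff_bdd B \<Longrightarrow> coeff_null (\<lambda>n. fps_const (c n) * B n)"
  unfolding coeff_null_def coeff_bdd_def by (auto intro!: tendsto_0_mult_Bseq)

text \<open>Dividing by \<open>R\<close> replaces differentiation by differentiation plus multiplication with the
  logarithmic derivative of \<open>R\<close>.\<close>

lemma rev_step_factor:
  fixes R u :: "real fps"
  assumes "R $ 0 \<noteq> 0"
  shows "rev_step h c (R * u) = R * (u - fps_const (h * c) * fps_X * u
      + fps_const h * fps_X ^ 2 * (fps_deriv R * inverse R) * u + fps_const h * fps_X ^ 2 * fps_deriv u)"
proof -
  have "R * (u - fps_const (h * c) * fps_X * u
      + fps_const h * fps_X ^ 2 * (fps_deriv R * inverse R) * u + fps_const h * fps_X ^ 2 * fps_deriv u)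
    = R * u - fps_const (h * c) * fps_X * (R * u) + fps_const h * fps_X ^ 2 * fps_deriv R * (inverse R * R) * u
      + fps_const h * fps_X ^ 2 * (R * fps_deriv u)"
    by (simp only: algebra_simps)
  also have "inverse R * R = 1" using assms by (rule inverse_mult_eq_1)
  finally show ?thesis
    by (simp add: rev_step_def algebra_simps)
qed

text \<open>This is the series \<open>E\<^sub>n\<close> of the introduction, for \<open>h = 1/n\<close>: an operator with parameter
  \<open>0\<close> maps \<open>R u\<close> to \<open>R (E u + h y\<^sup>2 u')\<close>.\<close>

definition log_deriv_fps :: "real \<Rightarrow> nat \<Rightarrow> real fps \<Rightarrow> real fps" where
  "log_deriv_fps h N R =
     1 - fps_const (h * real N) * fps_X + fps_const h * fps_X ^ 2 * (fps_deriv R * inverse R)"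

text \<open>In one step the factor \<open>u\<close> becomes \<open>(E - h (i + b) y) u + h y\<^sup>2 u'\<close>. The last summand and \<open>h i y\<close>
  vanish in the limit, because the number of steps is fixed, and \<open>h b\<close> tends to \<open>\<sigma>\<close>; so each
  step multiplies by \<open>E - \<sigma> y\<close> up to a null sequence.\<close>

lemma rev_steps_asymptotic:
  fixes R :: "nat \<Rightarrow> real fps" and h :: "nat \<Rightarrow> real" and N :: "nat \<Rightarrow> nat"
    and u :: "nat \<Rightarrow> real fps" and \<sigma> :: real
  defines "E \<equiv> \<lambda>n. log_deriv_fps (h n) (N n) (R n)"
  assumes h: "h \<longlonglongrightarrow> 0" and R0: "\<And>n. R n $ 0 = 1" and E: "coeff_bdd E"
  shows "coeff_bdd u \<Longrightarrow> (\<And>b. b \<in> set bs \<Longrightarrow> (\<lambda>n. h n * b n) \<longlonglongrightarrow> \<sigma>) \<Longrightarrow>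
    \<exists>V. (\<forall>n. rev_steps (h n) (N n + i) (map (\<lambda>b. b n) bs) (R n * u n) = R n * V n) \<and>
        coeff_null (\<lambda>n. V n - (E n - fps_const \<sigma> * fps_X) ^ length bs * u n)"
proof (induction bs arbitrary: i u)
  case Nil
  show ?case by (rule exI[of _ u]) (simp add: coeff_null_0)
next
  case (Cons b bs)
  define w where "w = (\<lambda>n. (E n - fps_const (h n * (real i + b n)) * fps_X) * u n
      + fps_const (h n) * (fps_X ^ 2 * fps_deriv (u n)))"
  have step: "rev_step (h n) (real (N n + i) + b n) (R n * u n) = R n * w n" for n
    by (subst rev_step_factor)
       (simp_all add: R0 w_def E_def log_deriv_fps_def algebra_simps flip: fps_const_add)
  let ?F = "\<lambda>n. E n - fps_const \<sigma> * fps_X"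
  have F: "coeff_bdd ?F"
    by (intro coeff_bdd_diff E coeff_bdd_const)
  have "(\<lambda>n. \<sigma> - (h n * real i + h n * b n)) \<longlonglongrightarrow> \<sigma> - (0 * real i + \<sigma>)"
    by (intro tendsto_intros h Cons.prems(2)) simp
  then have s: "(\<lambda>n. \<sigma> - h n * (real i + b n)) \<longlonglongrightarrow> 0"
    by (simp add: algebra_simps)
  have "coeff_null (\<lambda>n. fps_const (\<sigma> - h n * (real i + b n)) * (fps_X * u n)
      + fps_const (h n) * (fps_X ^ 2 * fps_deriv (u n)))"
    by (intro coeff_null_add coeff_null_const_mult s h coeff_bdd_mult coeff_bdd_const
        coeff_bdd_deriv Cons.prems(1))
  also have "(\<lambda>n. fps_const (\<sigma> - h n * (real i + b n)) * (fps_X * u n)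
      + fps_const (h n) * (fps_X ^ 2 * fps_deriv (u n))) = (\<lambda>n. w n - ?F n * u n)"
    by (rule ext) (simp add: w_def algebra_simps flip: fps_const_sub)
  finally have w: "coeff_null (\<lambda>n. w n - ?F n * u n)" .
  have "coeff_bdd (\<lambda>n. (w n - ?F n * u n) + ?F n * u n)"
    by (intro coeff_bdd_add coeff_null_imp_bdd[OF w] coeff_bdd_mult F Cons.prems(1))
  then have "coeff_bdd w" by simp
  then obtain V where V: "\<And>n. rev_steps (h n) (N n + Suc i) (map (\<lambda>b. b n) bs) (R n * w n) = R n * V n"
      and Vn: "coeff_null (\<lambda>n. V n - ?F n ^ length bs * w n)"
    using Cons.IH[of w "Suc i"] Cons.prems(2) by auto
  have "coeff_null (\<lambda>n. (V n - ?F n ^ length bs * w n) + (w n - ?F n * u n) * ?F n ^ length bs)"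
    by (intro coeff_null_add Vn coeff_null_mult w coeff_bdd_power F)
  also have "(\<lambda>n. (V n - ?F n ^ length bs * w n) + (w n - ?F n * u n) * ?F n ^ length bs)
      = (\<lambda>n. V n - ?F n ^ length (b # bs) * u n)"
    by (rule ext) (simp add: algebra_simps)
  finally show ?case using V step by (intro exI[of _ V]) simp
qed

lemma power_diff_factor_coeff_0:
  fixes A B :: "real fps"
  assumes "A $ 0 = 1" "B $ 0 = 1"
  shows "(\<Sum>i<k. A ^ i * B ^ (k - Suc i)) $ 0 = real k"
  using assms by (simp add: fps_sum_nth fps_power_zeroth)

text \<open>The difference of the two sides of the equation at \<open>E\<^sub>n\<close> is \<open>(E\<^sub>n - F) K\<^sub>n\<close>, where the
  divided difference \<open>K\<^sub>n\<close> has constant term \<open>(r + 1) - r = 1\<close> and is therefore invertible with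
  bounded coefficients.\<close>

lemma algebraic_equation_stable:
  fixes E :: "nat \<Rightarrow> real fps" and F :: "real fps"
  assumes E: "coeff_bdd E" and E0: "\<And>n. E n $ 0 = 1" and F0: "F $ 0 = 1"
    and F: "F ^ Suc r = (F - fps_X) ^ r"
    and null: "coeff_null (\<lambda>n. E n ^ Suc r - (E n - fps_X) ^ r)"
  shows "coeff_null (\<lambda>n. E n - F)"
proof -
  define K where "K = (\<lambda>n. (\<Sum>i<Suc r. E n ^ i * F ^ (Suc r - Suc i))
      - (\<Sum>i<r. (E n - fps_X) ^ i * (F - fps_X) ^ (r - Suc i)))"
  have K0: "K n $ 0 = 1" for n
    unfolding K_def fps_sub_nth by (subst power_diff_factor_coeff_0; simp add: E0 F0)+
  have K: "coeff_bdd K"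
    unfolding K_def
    by (intro coeff_bdd_diff coeff_bdd_sum coeff_bdd_mult coeff_bdd_power E coeff_bdd_const) auto
  have dif: "x ^ k - y ^ k = (x - y) * (\<Sum>i<k. x ^ i * y ^ (k - Suc i))" for x y :: "real fps" and k
    by (subst power_diff_sumr2) (simp add: mult.commute)
  have eq: "E n ^ Suc r - (E n - fps_X) ^ r = (E n - F) * K n" for n
  proof -
    have "E n ^ Suc r - (E n - fps_X) ^ r
        = (E n ^ Suc r - F ^ Suc r) - ((E n - fps_X) ^ r - (F - fps_X) ^ r)"
      using F by simp
    also have "\<dots> = (E n - F) * K n"
      unfolding dif[of _ "Suc r"] dif[of _ r] K_def by (simp only: algebra_simps)
    finally show ?thesis .
  qed
  have "coeff_null (\<lambda>n. (E n ^ Suc r - (E n - fps_X) ^ r) * inverse (K n))"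
    by (intro coeff_null_mult null coeff_bdd_inverse K K0)
  also have "(\<lambda>n. (E n ^ Suc r - (E n - fps_X) ^ r) * inverse (K n)) = (\<lambda>n. E n - F)"
    unfolding eq mult.assoc using K0 by (simp add: inverse_mult_eq_1')
  finally show ?thesis .
qed

section \<open>A linear bound for the zeros\<close>

text \<open>For \<open>R = \<Prod>\<^sub>k (1 - x\<^sub>k y)\<close> with \<open>N\<close> factors this is \<open>\<Sum>\<^sub>k 1 / (1 - x\<^sub>k y)\<close>, the generating function of
  all power sums.\<close>

definition power_sum_fps :: "nat \<Rightarrow> real fps \<Rightarrow> real fps" where
  "power_sum_fps N R = fps_const (real N) - fps_X * (fps_deriv R * inverse R)"

definition psum :: "nat \<Rightarrow> real \<Rightarrow> real fps \<Rightarrow> real" where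
  "psum K y A = (\<Sum>k\<le>K. A $ k * y ^ k)"

lemma psum_add: "psum K y (A + B) = psum K y A + psum K y B"
  by (simp add: psum_def algebra_simps sum.distrib)

lemma psum_1: "psum K y 1 = 1"
  by (simp add: psum_def if_distrib[of "\<lambda>c. c * _"] cong: if_cong)

lemma psum_const_mult: "psum K y (fps_const c * A) = c * psum K y A"
  by (simp add: psum_def sum_distrib_left mult.assoc)

lemma psum_nonneg: "(\<And>k. 0 \<le> A $ k) \<Longrightarrow> 0 \<le> y \<Longrightarrow> 0 \<le> psum K y A"
  by (simp add: psum_def sum_nonneg)

lemma psum_mult_le:
  assumes "\<And>k. 0 \<le> A $ k" "\<And>k. 0 \<le> B $ k" "0 \<le> y"
  shows "psum K y (A * B) \<le> psum K y A * psum K y B"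
proof -
  have "psum K y (A * B) = (\<Sum>k\<le>K. \<Sum>i=0..k. (A $ i * y ^ i) * (B $ (k - i) * y ^ (k - i)))"
    unfolding psum_def fps_mult_nth sum_distrib_right
    by (intro sum.cong refl) (auto simp: algebra_simps simp flip: power_add)
  also have "\<dots> = (\<Sum>(k, i)\<in>Sigma {..K} (\<lambda>k. {0..k}). (A $ i * y ^ i) * (B $ (k - i) * y ^ (k - i)))"
    by (rule sum.Sigma) auto
  also have "\<dots> = (\<Sum>(i, j)\<in>{(i, j). i + j \<le> K}. (A $ i * y ^ i) * (B $ j * y ^ j))"
    by (rule sum.reindex_bij_witness[of _ "\<lambda>(i, j). (i + j, i)" "\<lambda>(k, i). (i, k - i)"]) auto
  also have "\<dots> \<le> (\<Sum>(i, j)\<in>{..K} \<times> {..K}. (A $ i * y ^ i) * (B $ j * y ^ j))"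
    by (rule sum_mono2) (use assms in auto)
  also have "\<dots> = psum K y A * psum K y B"
    by (simp add: psum_def sum_product sum.cartesian_product)
  finally show ?thesis .
qed

lemma psum_X_mult_le:
  assumes "\<And>k. 0 \<le> A $ k" "0 \<le> y"
  shows "psum K y (fps_X * A) \<le> y * psum K y A"
proof -
  have "psum K y (fps_X :: real fps) \<le> y"
    using assms(2) by (simp add: psum_def fps_X_def if_distrib[of "\<lambda>c. c * _"] cong: if_cong)
  then have "psum K y fps_X * psum K y A \<le> y * psum K y A"
    by (rule mult_right_mono) (rule psum_nonneg[OF assms])
  moreover have "psum K y (fps_X * A) \<le> psum K y fps_X * psum K y A"
    by (rule psum_mult_le) (use assms in \<open>auto simp: fps_X_def\<close>)
  ultimately show ?thesis by linarith
qed

text \<open>The equation says \<open>C = 1 / (1 - A)\<close>.\<close>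

lemma geometric_nonneg:
  fixes A C :: "real fps"
  assumes A: "\<And>k. 0 \<le> A $ k" and A0: "A $ 0 = 0" and C: "C = 1 + A * C"
  shows "0 \<le> C $ k"
proof (induction k rule: less_induct)
  case (less k)
  have "C $ k = (1 + A * C) $ k" using C by simp
  also have "\<dots> = 1 $ k + (\<Sum>i=0..k. A $ i * C $ (k - i))"
    by (simp add: fps_mult_nth)
  also have "\<dots> \<ge> 0"
  proof (intro add_nonneg_nonneg sum_nonneg)
    fix i assume "i \<in> {0..k}"
    then show "0 \<le> A $ i * C $ (k - i)"
      using A A0 less by (cases "i = 0") auto
  qed (simp add: fps_one_def)
  finally show ?case .
qed

text \<open>Truncated sums are submultiplicative, so the truncation of \<open>C\<close> is at most \<open>1\<close> plus half of
  itself; no convergence has to be discussed.\<close>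

lemma psum_geometric_le_2:
  assumes A: "\<And>k. 0 \<le> A $ k" and A0: "A $ 0 = 0" and C: "C = 1 + A * C"
    and y: "0 \<le> y" and half: "psum K y A \<le> 1 / 2"
  shows "psum K y C \<le> 2"
proof -
  have Cn: "0 \<le> C $ k" for k by (rule geometric_nonneg[OF A A0 C])
  have "psum K y C = 1 + psum K y (A * C)"
    by (subst C) (simp add: psum_add psum_1)
  also have "psum K y (A * C) \<le> psum K y A * psum K y C"
    by (rule psum_mult_le) (use A Cn y in auto)
  also have "\<dots> \<le> 1 / 2 * psum K y C"
    by (rule mult_right_mono[OF half psum_nonneg[OF Cn y]])
  finally show ?thesis by simp
qed

text \<open>As a function of \<open>b\<close>, the value of \<open>A\<close> at \<open>1/b\<close> is a sum of the convex functions \<open>b\<^sup>-\<^sup>k\<close>, so it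
  decreases between \<open>b\<close> and \<open>b + d\<close> by at least \<open>d\<close> times the absolute slope at \<open>b + d\<close>. This slope
  is the value of \<open>y\<^sup>2 A'\<close>.\<close>

lemma psum_X2_deriv_le:
  fixes A :: "real fps"
  assumes A: "\<And>k. 0 \<le> A $ k" and b: "0 < b" and d: "0 < d"
  shows "d * psum K (1 / (b + d)) (fps_X ^ 2 * fps_deriv A) \<le> psum K (1 / b) A - psum K (1 / (b + d)) A"
proof -
  let ?Y = "1 / (b + d)" and ?y = "1 / b"
  have c: "(fps_X ^ 2 * fps_deriv A) $ Suc k = real k * A $ k" for k
    by (cases k) (simp_all add: fps_X_power_mult_nth)
  have "psum K ?Y (fps_X ^ 2 * fps_deriv A) \<le> psum (Suc K) ?Y (fps_X ^ 2 * fps_deriv A)"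
    unfolding psum_def sum.atMost_Suc c using A b d by simp
  also have "\<dots> = (\<Sum>k\<le>K. real k * A $ k * ?Y ^ Suc k)"
    unfolding psum_def sum.atMost_Suc_shift c by (simp add: fps_X_power_mult_nth)
  finally have "d * psum K ?Y (fps_X ^ 2 * fps_deriv A) \<le> d * (\<Sum>k\<le>K. real k * A $ k * ?Y ^ Suc k)"
    using d by (intro mult_left_mono) auto
  also have "\<dots> = (\<Sum>k\<le>K. A $ k * (d * real k * ?Y ^ Suc k))"
    unfolding sum_distrib_left by (intro sum.cong refl) (simp only: mult_ac)
  also have "\<dots> \<le> (\<Sum>k\<le>K. A $ k * (?y ^ k - ?Y ^ k))"
  proof (intro sum_mono mult_left_mono A)
    fix k
    have "1 + real k * (d / b) \<le> (1 + d / b) ^ k"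
      by (rule Bernoulli_inequality) (use b d in \<open>simp add: field_simps\<close>)
    moreover have "real k * (d / (b + d)) \<le> real k * (d / b)"
      using b d by (intro mult_left_mono divide_left_mono) auto
    ultimately have "real k * (d / (b + d)) + 1 \<le> ((b + d) / b) ^ k"
      using b by (simp add: add_divide_distrib)
    then have "(real k * (d / (b + d)) + 1) * ?Y ^ k \<le> ((b + d) / b) ^ k * ?Y ^ k"
      using b d by (intro mult_right_mono) auto
    also have "((b + d) / b) ^ k * ?Y ^ k = ?y ^ k"
      using b d by (simp flip: power_mult_distrib)
    finally show "d * real k * ?Y ^ Suc k \<le> ?y ^ k - ?Y ^ k"
      by (simp add: algebra_simps)
  qed
  also have "\<dots> = psum K ?y A - psum K ?Y A"
    by (simp add: psum_def right_diff_distrib sum_subtractf)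
  finally show ?thesis .
qed

text \<open>The point \<open>b\<close> bounds the zeros: for nonnegative power sums \<open>p\<^sub>k\<close>, the inequality
  \<open>\<Sum>\<^sub>k p\<^sub>k / b\<^sup>k \<le> 2 N\<close> gives \<open>p\<^sub>k \<le> 2 N b\<^sup>k\<close>. Nonnegativity is carried along because it replaces any
  knowledge of the zeros of the intermediate polynomials.\<close>

definition barrier :: "nat \<Rightarrow> real \<Rightarrow> real fps \<Rightarrow> bool" where
  "barrier N b R \<longleftrightarrow> R $ 0 = 1 \<and> (\<forall>k. 0 \<le> power_sum_fps N R $ k) \<and>
     (\<forall>K. psum K (1 / b) (power_sum_fps N R) \<le> 2 * real N)"

text \<open>Let \<open>H\<close> be the power sum series and \<open>C = 1 / (1 - \<beta> y - y H)\<close>. One step replaces \<open>H\<close> by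
  \<open>H + (1 + y\<^sup>2 H') C\<close>, which again has nonnegative coefficients. At \<open>y = 1 / (b + 2)\<close> the size of
  \<open>b\<close> makes \<open>C \<le> 2\<close>; the term \<open>2 y\<^sup>2 H'\<close> is then paid for by the decrease of \<open>H\<close> on the way
  from \<open>b\<close> to \<open>b + 2\<close>, and what remains is an increase by \<open>2\<close>.\<close>

lemma barrier_step:
  assumes R: "barrier N b R" and \<beta>: "0 \<le> \<beta>" and b: "0 < b" "2 * (\<beta> + 2 * real N) \<le> b"
  shows "barrier (Suc N) (b + 2) (rev_step 1 (real N + \<beta>) R)"
proof -
  define H where "H = power_sum_fps N R"
  have R0: "R $ 0 = 1" and H: "\<And>k. 0 \<le> H $ k" and S: "\<And>K. psum K (1 / b) H \<le> 2 * real N"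
    using R by (auto simp: barrier_def H_def)
  define A where "A = fps_X * (fps_const \<beta> + H)"
  define C where "C = inverse (1 - A)"
  define R' where "R' = rev_step 1 (real N + \<beta>) R"
  have A: "0 \<le> A $ k" for k
    using H \<beta> by (auto simp: A_def intro!: add_nonneg_nonneg)
  have A0: "A $ 0 = 0" by (simp add: A_def)
  have Q: "C * (1 - A) = 1" unfolding C_def by (rule inverse_mult_eq_1) (simp add: A0)
  then have C: "C = 1 + A * C" by (simp add: algebra_simps)
  have "rev_step 1 (real N + \<beta>) (R * 1) = R * (1 - A)"
    unfolding rev_step_factor[of R, unfolded R0, OF one_neq_zero]
    by (simp add: A_def H_def power_sum_fps_def algebra_simps power2_eq_square)
  then have R': "R' = R * (1 - A)" by (simp add: R'_def)
  have R'0: "R' $ 0 = 1" by (simp add: R' R0 A0)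
  \<comment> \<open>As \<open>A = y (\<beta> + H)\<close>, the derivative \<open>y d/dy\<close> reproduces \<open>A\<close> and adds \<open>y\<^sup>2 H'\<close>.\<close>
  have dA: "fps_X * fps_deriv A = A + fps_X ^ 2 * fps_deriv H"
    by (simp add: A_def algebra_simps power2_eq_square)
  have H': "power_sum_fps (Suc N) R' = H + (1 + fps_X ^ 2 * fps_deriv H) * C"
  proof -
    have iR: "inverse R * R = 1" by (rule inverse_mult_eq_1) (simp add: R0)
    have "fps_deriv R' * inverse R' = (fps_deriv R * (1 - A) - R * fps_deriv A) * (inverse R * C)"
      by (simp add: R' C_def fps_inverse_mult)
    also have "\<dots> = fps_deriv R * inverse R * (C * (1 - A)) - (inverse R * R) * fps_deriv A * C"
      by (simp add: algebra_simps)
    also have "\<dots> = fps_deriv R * inverse R - fps_deriv A * C"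
      by (simp add: Q iR)
    finally have *: "fps_deriv R' * inverse R' = fps_deriv R * inverse R - fps_deriv A * C" .
    have "power_sum_fps (Suc N) R' = H + (1 + (fps_X * fps_deriv A) * C)"
      unfolding power_sum_fps_def H_def * by (simp add: algebra_simps flip: fps_const_add)
    also have "1 + (fps_X * fps_deriv A) * C = (1 + A * C) + fps_X ^ 2 * fps_deriv H * C"
      by (simp add: dA algebra_simps)
    also have "\<dots> = (1 + fps_X ^ 2 * fps_deriv H) * C"
      using C by (simp add: algebra_simps)
    finally show ?thesis .
  qed
  let ?D = "fps_X ^ 2 * fps_deriv H"
  have Dn: "0 \<le> ?D $ k" for k
    using H by (auto simp: fps_X_power_mult_nth)
  have Dn1: "0 \<le> (1 + ?D) $ k" for k
    using Dn[of k] by (auto simp: fps_one_def)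
  have Cn: "0 \<le> C $ k" for k by (rule geometric_nonneg[OF A A0 C])
  have "0 \<le> power_sum_fps (Suc N) R' $ k" for k
    unfolding H' fps_add_nth[of H] fps_mult_nth[of "1 + ?D"]
    by (intro add_nonneg_nonneg H sum_nonneg mult_nonneg_nonneg Cn Dn1)
  moreover have "psum K (1 / (b + 2)) (power_sum_fps (Suc N) R') \<le> 2 * real (Suc N)" for K
  proof -
    let ?Y = "1 / (b + 2)"
    have Y: "0 \<le> ?Y" using b by simp
    have conv: "2 * psum K ?Y ?D \<le> psum K (1 / b) H - psum K ?Y H"
      by (rule psum_X2_deriv_le) (use H b in auto)
    have "0 \<le> psum K ?Y ?D" by (rule psum_nonneg[OF Dn Y])
    then have HY: "psum K ?Y H \<le> 2 * real N" using conv S[of K] by linarith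
    have "psum K ?Y A \<le> ?Y * psum K ?Y (fps_const \<beta> + H)"
      unfolding A_def by (rule psum_X_mult_le) (use H \<beta> Y in auto)
    also have "psum K ?Y (fps_const \<beta> + H) = \<beta> + psum K ?Y H"
      using psum_const_mult[of K ?Y \<beta> 1] by (simp add: psum_add psum_1)
    also have "?Y * (\<beta> + psum K ?Y H) \<le> ?Y * (\<beta> + 2 * real N)"
      using HY Y by (intro mult_left_mono) auto
    also have "\<dots> \<le> 1 / 2"
      using b by (simp add: field_simps)
    finally have "psum K ?Y C \<le> 2"
      by (intro psum_geometric_le_2[OF A A0 C Y])
    moreover have "0 \<le> psum K ?Y (1 + ?D)" by (rule psum_nonneg[OF Dn1 Y])
    moreover have "psum K ?Y ((1 + ?D) * C) \<le> psum K ?Y (1 + ?D) * psum K ?Y C"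
      by (rule psum_mult_le[OF Dn1 Cn Y])
    ultimately have "psum K ?Y ((1 + ?D) * C) \<le> psum K ?Y (1 + ?D) * 2"
      by (meson mult_left_mono order_trans)
    then have "psum K ?Y (power_sum_fps (Suc N) R') \<le> psum K ?Y H + (1 + psum K ?Y ?D) * 2"
      by (simp add: H' psum_add psum_1)
    then show ?thesis using conv S[of K] by simp
  qed
  ultimately show ?thesis using R'0 by (auto simp: barrier_def R'_def)
qed

lemma barrier_rev_steps:
  assumes "barrier N b R" "0 < b" "\<And>\<beta>. \<beta> \<in> set bs \<Longrightarrow> 0 \<le> \<beta> \<and> \<beta> \<le> B"
    "2 * (B + 2 * real (N + length bs)) \<le> b"
  shows "barrier (N + length bs) (b + 2 * real (length bs)) (rev_steps 1 N bs R)"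
  using assms
proof (induction bs arbitrary: N b R)
  case (Cons \<beta> bs)
  have "barrier (Suc N) (b + 2) (rev_step 1 (real N + \<beta>) R)"
    using Cons.prems(3)[of \<beta>] Cons.prems(4) by (intro barrier_step Cons.prems) auto
  from Cons.IH[OF this] Cons.prems show ?case by (simp add: algebra_simps)
qed simp

lemma barrier_0: "barrier 0 b 1"
  by (simp add: barrier_def power_sum_fps_def psum_def)

lemma bounded_powers_imp_le:
  fixes a b C :: real
  assumes "0 < b" "0 \<le> a" "\<And>m. m \<ge> 1 \<Longrightarrow> a ^ m / b ^ m \<le> C"
  shows "a \<le> b"
proof (rule ccontr)
  assume "\<not> a \<le> b"
  then have "1 < a / b" using assms(1) by simp
  then obtain n where n: "C < (a / b) ^ n" using real_arch_pow by blast
  have "(a / b) ^ n \<le> (a / b) ^ Suc n" using \<open>1 < a / b\<close> by (intro power_increasing) auto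
  also have "\<dots> \<le> C" using assms(3)[of "Suc n"] by (simp only: power_divide)
  finally show False using n by simp
qed

section \<open>The limit series and Lagrange inversion\<close>

text \<open>With \<open>P = X \<psi>\<close>, this coefficient is the residue of \<open>P' / P\<^sup>e\<^sup>+\<^sup>1\<close>. For positive \<open>e\<close> the latter is
  the derivative of \<open>- 1 / (e P\<^sup>e)\<close> and has no residue.\<close>

lemma residue_log_derivative_power:
  fixes \<psi> :: "real fps"
  assumes "\<psi> $ 0 = 1"
  shows "(fps_deriv (fps_X * \<psi>) * inverse (\<psi> ^ Suc e)) $ e = (if e = 0 then 1 else 0)"
proof (cases "e = 0")
  case True
  then show ?thesis using assms by (simp add: fps_mult_nth)
next
  case False
  have u: "\<psi> * inverse \<psi> = 1" using assms by (simp add: inverse_mult_eq_1')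
  define W where "W = inverse \<psi> ^ e"
  have dW: "fps_deriv W = - of_nat e * (fps_deriv \<psi> * inverse \<psi> ^ Suc e)"
  proof -
    obtain d where e: "e = Suc d" using False by (cases e) auto
    have "fps_deriv W = of_nat e * (- fps_deriv \<psi> * (inverse \<psi>)\<^sup>2) * inverse \<psi> ^ d"
      unfolding W_def fps_deriv_power using assms
      by (simp add: fps_inverse_deriv e fps_of_nat del: of_nat_Suc)
    then show ?thesis by (simp only: e power_Suc power2_eq_square mult_ac mult_minus_left mult_minus_right)
  qed
  have "of_nat e * (fps_deriv (fps_X * \<psi>) * inverse (\<psi> ^ Suc e))
      = of_nat e * (\<psi> * inverse \<psi>) * W + fps_X * (of_nat e * (fps_deriv \<psi> * inverse \<psi> ^ Suc e))"
    unfolding W_def fps_inverse_power by (simp add: algebra_simps)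
  also have "\<dots> = of_nat e * W - fps_X * fps_deriv W"
    by (simp add: u dW)
  finally have "real e * (fps_deriv (fps_X * \<psi>) * inverse (\<psi> ^ Suc e)) $ e
      = real e * W $ e - (fps_X * fps_deriv W) $ e"
    by (metis fps_mult_of_nat_nth(1) fps_sub_nth)
  then show ?thesis using False by simp
qed

text \<open>Lagrange inversion for \<open>K\<close> expanded in powers of \<open>P = X \<psi>\<close>: after differentiation and
  division by \<open>P\<^sup>m\<^sup>+\<^sup>1\<close>, all terms except the one with \<open>P' / P\<close> are free of residues.\<close>

lemma lagrange_inversion:
  fixes \<psi> K :: "real fps"
  assumes \<psi>: "\<psi> $ 0 = 1"
  shows "real (Suc m) * K $ Suc m
       = (fps_deriv (K oo (fps_X * \<psi>)) * inverse (\<psi> ^ Suc m)) $ m"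
proof -
  define P where "P = fps_X * \<psi>"
  define Q where "Q = fps_deriv P * inverse (\<psi> ^ Suc m)"
  have PQ: "(P ^ j * Q) $ m = (if j = m then 1 else 0)" if "j \<le> m" for j
  proof -
    have "\<psi> ^ j * inverse (\<psi> ^ Suc m) = inverse (\<psi> ^ Suc (m - j))"
    proof -
      have "\<psi> ^ Suc m = \<psi> ^ j * \<psi> ^ Suc (m - j)" using that by (simp flip: power_add power_Suc)
      then have "\<psi> ^ j * inverse (\<psi> ^ Suc m) = (\<psi> ^ j * inverse (\<psi> ^ j)) * inverse (\<psi> ^ Suc (m - j))"
        by (simp only: fps_inverse_mult mult.assoc)
      moreover have "\<psi> ^ j * inverse (\<psi> ^ j) = 1" using \<psi> by (intro inverse_mult_eq_1') (simp add: fps_power_zeroth)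
      ultimately show ?thesis by simp
    qed
    then have "P ^ j * Q = fps_X ^ j * (fps_deriv P * inverse (\<psi> ^ Suc (m - j)))"
      by (simp add: P_def Q_def power_mult_distrib mult_ac)
    then show ?thesis
      using that residue_log_derivative_power[OF \<psi>, of "m - j"] unfolding P_def
      by (auto simp: fps_X_power_mult_nth)
  qed
  have P0: "P $ 0 = 0" by (simp add: P_def)
  have tr: "((fps_deriv K oo P) * Q) $ m = (\<Sum>j=0..m. fps_deriv K $ j * (P ^ j * Q) $ m)"
  proof -
    have "((fps_deriv K oo P) * Q) $ m
        = (\<Sum>i=0..m. (\<Sum>j=0..m. fps_deriv K $ j * (P ^ j $ i)) * Q $ (m - i))"
    proof -
      have "(\<Sum>j=0..i. fps_deriv K $ j * (P ^ j $ i)) = (\<Sum>j=0..m. fps_deriv K $ j * (P ^ j $ i))"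
        if "i \<in> {0..m}" for i
        using that by (intro sum.mono_neutral_left) (auto simp: startsby_zero_power_prefix[OF P0])
      then show ?thesis
        unfolding fps_mult_nth fps_compose_nth by (intro sum.cong[OF refl]) (simp only:)
    qed
    also have "\<dots> = (\<Sum>j=0..m. \<Sum>i=0..m. fps_deriv K $ j * (P ^ j $ i) * Q $ (m - i))"
      unfolding sum_distrib_right by (rule sum.swap)
    also have "\<dots> = (\<Sum>j=0..m. fps_deriv K $ j * (P ^ j * Q) $ m)"
      by (simp add: fps_mult_nth[of _ Q] sum_distrib_left mult.assoc)
    finally show ?thesis .
  qed
  have "(fps_deriv (K oo P) * inverse (\<psi> ^ Suc m)) $ m = ((fps_deriv K oo P) * Q) $ m"
    by (simp add: fps_compose_deriv[OF P0] Q_def mult.assoc)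
  also have "\<dots> = (\<Sum>j=0..m. fps_deriv K $ j * (if j = m then 1 else 0))"
    unfolding tr by (intro sum.cong refl) (simp add: PQ)
  also have "\<dots> = fps_deriv K $ m"
    by (simp add: if_distrib[of "\<lambda>c. _ * c"] cong: if_cong)
  finally show ?thesis by (simp add: P_def add.commute)
qed

text \<open>If \<open>v\<close> denotes the solution of \<open>v (1 - v)\<^sup>r = y\<close> with \<open>v(0) = 0\<close>, then \<open>E = (1 - v)\<^sup>r\<close> satisfies
  \<open>E - y = (1 - v)\<^sup>r (1 - v) = (1 - v)\<^sup>r\<^sup>+\<^sup>1\<close> and hence \<open>E\<^sup>r\<^sup>+\<^sup>1 = (E - y)\<^sup>r\<close>.\<close>

definition limit_fps :: "nat \<Rightarrow> real fps" where
  "limit_fps r = (1 - fps_X) ^ r oo fps_inv (fps_X * (1 - fps_X) ^ r)"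

lemma limit_fps_equation: "limit_fps r ^ Suc r = (limit_fps r - fps_X) ^ r"
  and limit_fps_0: "limit_fps r $ 0 = 1"
  and limit_fps_coeff:
    "r \<ge> 1 \<Longrightarrow> limit_fps r $ Suc m = - real r * (real (((r + 1) * m) choose m) / real (m + 1))"
proof -
  define P where "P = fps_X * (1 - fps_X :: real fps) ^ r"
  define v where "v = fps_inv P"
  have P0: "P $ 0 = 0" and P1: "P $ 1 \<noteq> 0" by (simp_all add: P_def fps_power_zeroth)
  have v0: "v $ 0 = 0" by (simp add: v_def fps_inv_def)
  have F: "limit_fps r = (1 - fps_X) ^ r oo v" by (simp add: limit_fps_def v_def P_def)
  have "limit_fps r - fps_X = ((1 - fps_X) ^ r - P) oo v"
    using fps_inv_right[OF P0 P1] by (simp add: F fps_compose_sub_distrib v_def)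
  also have "(1 - fps_X) ^ r - P = (1 - fps_X) ^ Suc r" by (simp add: P_def algebra_simps)
  finally have "(limit_fps r - fps_X) ^ r = (1 - fps_X) ^ (Suc r * r) oo v"
    by (simp only: fps_compose_power[OF v0] power_mult)
  also have "\<dots> = limit_fps r ^ Suc r"
    unfolding F by (subst fps_compose_power[OF v0]) (simp only: mult.commute flip: power_mult)
  finally show "limit_fps r ^ Suc r = (limit_fps r - fps_X) ^ r" by simp
  show "limit_fps r $ 0 = 1" by (simp add: F fps_power_zeroth)
  assume r: "r \<ge> 1"
  have comp: "limit_fps r oo P = (1 - fps_X) ^ r"
    unfolding F using fps_inv[OF P0 P1]
    by (subst fps_compose_assoc[OF P0 v0, symmetric]) (simp add: v_def)
  have inv: "(1 - fps_X :: real fps) ^ k * inverse ((1 - fps_X) ^ k) = 1" for k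
    by (intro inverse_mult_eq_1') (simp add: fps_power_zeroth)
  have "real (Suc m) * limit_fps r $ Suc m
      = (fps_deriv ((1 - fps_X) ^ r) * inverse (((1 - fps_X) ^ r) ^ Suc m)) $ m"
    using lagrange_inversion[of "(1 - fps_X) ^ r" m "limit_fps r"] comp
    by (simp add: P_def fps_power_zeroth)
  also have "((1 - fps_X :: real fps) ^ r) ^ Suc m = (1 - fps_X) ^ (r - 1) * (1 - fps_X) ^ (r * m + 1)"
  proof -
    have "r * Suc m = (r - 1) + (r * m + 1)" using r by simp
    then show ?thesis by (simp only: flip: power_mult power_add)
  qed
  also have "fps_deriv ((1 - fps_X) ^ r) * inverse ((1 - fps_X) ^ (r - 1) * (1 - fps_X :: real fps) ^ (r * m + 1))
      = - fps_const (real r) * ((1 - fps_X) ^ (r - 1) * inverse ((1 - fps_X) ^ (r - 1)))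
          * inverse ((1 - fps_X) ^ (r * m + 1))"
    by (simp add: fps_deriv_power fps_inverse_mult fps_of_nat mult_ac del: power_Suc)
  also have "\<dots> = - fps_const (real r) * inverse ((1 - fps_X) ^ (r * m + 1))"
    by (simp add: inv)
  also have "(- fps_const (real r) * inverse ((1 - fps_X) ^ (r * m + 1))) $ m
      = - real r * real (((r + 1) * m) choose m)"
    using one_minus_const_fps_X_neg_power'[of "r * m + 1" "1 :: real"]
    by (simp add: algebra_simps)
  finally show "limit_fps r $ Suc m = - real r * (real (((r + 1) * m) choose m) / real (m + 1))"
    by (simp add: field_simps)
qed

section \<open>The moments of the density\<close>

text \<open>The sum is the geometric one for \<open>sin ((r + 1) w) / sin w \<cdot> exp (- \<i> r w)\<close>. In this form the
  curve is entire, in particular regular at the end point \<open>0\<close>.\<close>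

definition s_curve :: "nat \<Rightarrow> complex \<Rightarrow> complex" where
  "s_curve r w = (\<Sum>k\<le>r. exp (- 2 * \<i> * of_nat k * w))"

definition s_curve_deriv :: "nat \<Rightarrow> complex \<Rightarrow> complex" where
  "s_curve_deriv r w = (\<Sum>k\<le>r. - 2 * \<i> * of_nat k * exp (- 2 * \<i> * of_nat k * w))"

lemma s_curve_has_field_derivative:
  "(s_curve r has_field_derivative s_curve_deriv r w) (at w)"
  unfolding s_curve_def[abs_def] s_curve_deriv_def
  by (auto intro!: derivative_eq_intros sum.cong)

lemma s_curve_times_sin:
  "s_curve r (of_real \<phi>) * of_real (sin \<phi>) = of_real (sin (real (r + 1) * \<phi>)) * cis (- (real r * \<phi>))"
proof (induction r)
  case 0
  then show ?case by (simp add: s_curve_def)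
next
  case (Suc r)
  define t where "t = real (r + 1) * \<phi>"
  have e: "exp (- 2 * \<i> * of_nat (Suc r) * of_real \<phi>) = cis (- t) * cis (- t)"
    by (simp add: cis_mult t_def) (simp add: cis_conv_exp algebra_simps)
  have c: "cis (- (real r * \<phi>)) = cis (- t) * cis \<phi>"
    by (simp add: cis_mult t_def algebra_simps)
  have "of_real (sin t) * cis \<phi> + cis (- t) * of_real (sin \<phi>) = complex_of_real (sin (t + \<phi>))"
    by (simp add: complex_eq_iff sin_add algebra_simps)
  then have k: "cis (- t) * (of_real (sin t) * cis \<phi> + cis (- t) * of_real (sin \<phi>))
      = cis (- t) * of_real (sin (t + \<phi>))" by simp
  have "s_curve (Suc r) (of_real \<phi>) * of_real (sin \<phi>)
      = s_curve r (of_real \<phi>) * of_real (sin \<phi>) + cis (- t) * cis (- t) * of_real (sin \<phi>)"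
    unfolding s_curve_def sum.atMost_Suc e by (simp add: algebra_simps)
  also have "\<dots> = cis (- t) * of_real (sin (t + \<phi>))"
    unfolding Suc c k[symmetric] t_def[symmetric] by (simp add: algebra_simps)
  finally show ?case by (simp add: t_def algebra_simps)
qed

lemma z_curve_times_sin:
  "(s_curve r (of_real \<phi>) - 1) * of_real (sin \<phi>)
     = of_real (sin (real r * \<phi>)) * cis (- (real (r + 1) * \<phi>))"
proof -
  define t where "t = real (r + 1) * \<phi>"
  have c: "cis (- (real r * \<phi>)) = cis (- t) * cis \<phi>"
    by (simp add: cis_mult t_def algebra_simps)
  have "complex_of_real (sin t) * cis \<phi> - of_real (sin \<phi>) * cis t = of_real (sin (t - \<phi>))"
    by (simp add: complex_eq_iff sin_diff algebra_simps)
  then have k: "cis (- t) * (of_real (sin t) * cis \<phi> - of_real (sin \<phi>) * cis t)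
      = cis (- t) * of_real (sin (t - \<phi>))" by simp
  have "cis (- t) * cis t = 1" by (simp add: cis_mult)
  then have "cis (- t) * (of_real (sin t) * cis \<phi> - of_real (sin \<phi>) * cis t) =
     of_real (sin t) * (cis (- t) * cis \<phi>) - of_real (sin \<phi>)"
    by (simp add: right_diff_distrib mult.left_commute)
  then show ?thesis
    using s_curve_times_sin[of r \<phi>] k unfolding c t_def[symmetric]
    by (simp add: left_diff_distrib t_def) (simp add: algebra_simps)
qed

lemma has_real_derivative_Im_Re:
  assumes "(F has_field_derivative D) (at (complex_of_real x))"
  shows "((\<lambda>x. Im (F (of_real x))) has_real_derivative Im D) (at x)"
    "((\<lambda>x. Re (F (of_real x))) has_real_derivative Re D) (at x)"
  using has_vector_derivative_real_field[OF assms]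
  by (auto intro: has_field_derivative_Im has_field_derivative_Re)

lemma sin_cos_of_nat_mult_of_real:
  "sin (of_nat k * complex_of_real x) = of_real (sin (real k * x))"
  "cos (of_nat k * complex_of_real x) = of_real (cos (real k * x))"
  by (metis of_real_mult of_real_of_nat_eq sin_of_real cos_of_real)+

context
  fixes r :: nat
  assumes r: "r \<ge> 1"
begin

lemma sin_positive:
  assumes "0 < \<phi>" "\<phi> < pi / real (r + 1)"
  shows "sin \<phi> > 0" "sin (real r * \<phi>) > 0" "sin (real (r + 1) * \<phi>) > 0"
proof -
  have a: "real (r + 1) * \<phi> < pi" using assms by (simp add: field_simps)
  have b: "real r * \<phi> < real (r + 1) * \<phi>" using assms by (simp add: algebra_simps)
  have c: "\<phi> \<le> real r * \<phi>" using assms r by simp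
  show "sin \<phi> > 0" "sin (real r * \<phi>) > 0" "sin (real (r + 1) * \<phi>) > 0"
    by (rule sin_gt_zero; use assms a b c in linarith)+
qed

lemma z_curve_0: "s_curve r 0 - 1 = of_nat r"
  by (simp add: s_curve_def)

lemma z_curve_end: "s_curve r (of_real (pi / real (r + 1))) - 1 = - 1"
proof -
  have "sin (pi / real (r + 1)) > 0"
    by (rule sin_gt_zero) (use r in \<open>auto simp: divide_less_eq\<close>)
  moreover have "real r * (pi / real (r + 1)) = pi - (pi / real (r + 1))" by (simp add: field_simps)
  then have "sin (real r * (pi / real (r + 1))) = sin (pi / real (r + 1))" by simp
  moreover have "cis (- (real (r + 1) * (pi / real (r + 1)))) = - 1" by (simp add: complex_eq_iff)
  ultimately show ?thesis using z_curve_times_sin[of r "pi / real (r + 1)"]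
    by (simp add: field_simps del: of_real_divide)
qed

lemma z_curve_nonzero:
  assumes "0 \<le> \<phi>" "\<phi> \<le> pi / real (r + 1)"
  shows "s_curve r (of_real \<phi>) - 1 \<noteq> 0"
proof -
  consider "\<phi> = 0" | "\<phi> = (pi / real (r + 1))" | "0 < \<phi>" "\<phi> < pi / real (r + 1)" using assms by linarith
  then show ?thesis
  proof cases
    case 1
    then show ?thesis using z_curve_0 r by simp
  next
    case 2
    then show ?thesis using z_curve_end by simp
  next
    case 3
    have "of_real (sin (real r * \<phi>)) * cis (- (real (r + 1) * \<phi>)) \<noteq> 0"
      using sin_positive[OF 3] by simp
    then show ?thesis using z_curve_times_sin[of r \<phi>] by auto
  qed
qed

text \<open>For \<open>k \<noteq> - 1\<close> the primitive is a power of \<open>s - 1\<close>, which is real at both ends \<open>s - 1 = r\<close> and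
  \<open>s - 1 = - 1\<close>. For \<open>k = - 1\<close> the imaginary part of the primitive is the argument of \<open>s - 1\<close>, which
  is \<open>- (r + 1) \<phi>\<close> and runs from \<open>0\<close> to \<open>- \<pi>\<close>.\<close>

lemma power_curve_integral:
  fixes k :: int
  shows "((\<lambda>\<phi>. Im ((s_curve r (of_real \<phi>) - 1) powi k * s_curve_deriv r (of_real \<phi>)))
     has_integral (if k = -1 then - pi else 0)) {0..pi / real (r + 1)}"
proof (cases "k = -1")
  case False
  define A where "A = (\<lambda>w. (s_curve r w - 1) powi (k + 1) / of_int (k + 1))"
  have k1: "of_int (k + 1) \<noteq> (0::complex)" using False by (metis add_eq_0_iff2 of_int_eq_0_iff)
  have A: "(A has_field_derivative (s_curve r (of_real \<phi>) - 1) powi k * s_curve_deriv r (of_real \<phi>))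
      (at (of_real \<phi>))" if "\<phi> \<in> {0..pi / real (r + 1)}" for \<phi>
  proof -
    have "((\<lambda>w. s_curve r w - 1) has_field_derivative s_curve_deriv r (of_real \<phi>)) (at (of_real \<phi>))"
      using s_curve_has_field_derivative by (auto intro!: derivative_eq_intros)
    from DERIV_power_int[OF this, of "k + 1"]
    have "((\<lambda>w. (s_curve r w - 1) powi (k + 1)) has_field_derivative
        of_int (k + 1) * (s_curve r (of_real \<phi>) - 1) powi k * s_curve_deriv r (of_real \<phi>)) (at (of_real \<phi>))"
      using z_curve_nonzero[of \<phi>] that by simp
    from DERIV_cdivide[OF this, of "of_int (k + 1)"] show ?thesis
      unfolding A_def using k1 by (simp add: field_simps del: of_int_add)
  qed
  have "((\<lambda>\<phi>. Im ((s_curve r (of_real \<phi>) - 1) powi k * s_curve_deriv r (of_real \<phi>)))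
     has_integral (Im (A (of_real (pi / real (r + 1)))) - Im (A (of_real 0)))) {0..pi / real (r + 1)}"
  proof (rule fundamental_theorem_of_calculus)
    fix \<phi> assume "\<phi> \<in> {0..pi / real (r + 1)}"
    from has_real_derivative_Im_Re(1)[OF A[OF this]]
    show "((\<lambda>\<phi>. Im (A (of_real \<phi>))) has_vector_derivative
        Im ((s_curve r (of_real \<phi>) - 1) powi k * s_curve_deriv r (of_real \<phi>))) (at \<phi> within {0..pi / real (r + 1)})"
      unfolding has_real_derivative_iff_has_vector_derivative by (rule has_vector_derivative_at_within)
  qed simp
  moreover have "Im (A (of_real (pi / real (r + 1)))) = 0"
    unfolding A_def z_curve_end by (auto simp: power_int_minus_left simp flip: of_int_add)
  moreover have "Im (A (of_real 0)) = 0"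
    unfolding A_def of_real_0 z_curve_0 
    by (metis Im_complex_of_real of_real_divide of_real_of_int_eq of_real_of_nat_eq of_real_power_int)
  ultimately show ?thesis using False by simp
next
  case True
  let ?z = "\<lambda>\<phi>. s_curve r (of_real \<phi>) - 1"
  have der: "((\<lambda>\<phi>. - (real (r + 1) * \<phi>)) has_vector_derivative
      Im (?z \<phi> powi k * s_curve_deriv r (of_real \<phi>))) (at \<phi>)"
    if \<phi>: "\<phi> \<in> {0<..<pi / real (r + 1)}" for \<phi>
  proof -
    \<comment> \<open>Polar form \<open>s - 1 = \<rho> exp (- \<i> (r + 1) \<phi>)\<close> with \<open>\<rho>\<close> real on the real axis, so the
      imaginary part of the logarithmic derivative comes from the exponential alone.\<close>
    define \<rho> where "\<rho> = (\<lambda>w. sin (of_nat r * w) / sin w :: complex)"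
    define G where "G = (\<lambda>w. \<rho> w * exp (- \<i> * of_nat (r + 1) * w))"
    have s: "sin (complex_of_real \<phi>) \<noteq> 0" "sin (of_nat r * complex_of_real \<phi>) \<noteq> 0"
      using sin_positive[of \<phi>] \<phi> by (auto simp: sin_of_real sin_cos_of_nat_mult_of_real)
    define d where "d = ((of_nat r * cos (of_nat r * of_real \<phi>)) * sin (of_real \<phi>)
        - sin (of_nat r * of_real \<phi>) * cos (of_real \<phi>)) / (sin (of_real \<phi>) * sin (of_real \<phi>) :: complex)"
    have d: "(\<rho> has_field_derivative d) (at (of_real \<phi>))"
      unfolding \<rho>_def d_def using s by (auto intro!: derivative_eq_intros)
    have dreal: "d \<in> \<real>" "\<rho> (of_real \<phi>) \<in> \<real>"
      unfolding d_def \<rho>_def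
      by (auto intro!: Reals_divide Reals_mult Reals_diff
           simp: sin_of_real cos_of_real sin_cos_of_nat_mult_of_real)
    have \<rho>0: "\<rho> (of_real \<phi>) \<noteq> 0" using s by (simp add: \<rho>_def)
    have GD: "(G has_field_derivative (d - \<i> * of_nat (r + 1) * \<rho> (of_real \<phi>))
        * exp (- \<i> * of_nat (r + 1) * of_real \<phi>)) (at (of_real \<phi>))"
      unfolding G_def using d by (auto intro!: derivative_eq_intros simp: algebra_simps)
    have GZ: "G (of_real x) = ?z x" if "x \<in> {0<..<pi / real (r + 1)}" for x
      using z_curve_times_sin[of r x] sin_positive[of x] that
      by (simp add: G_def \<rho>_def field_simps cis_conv_exp sin_of_real sin_cos_of_nat_mult_of_real)
    have "((\<lambda>x. G (of_real x)) has_vector_derivative s_curve_deriv r (of_real \<phi>)) (at \<phi>)"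
    proof (rule has_vector_derivative_transform_within_open[where S = "{0<..<pi / real (r + 1)}"])
      have "((\<lambda>w. s_curve r w - 1) has_field_derivative s_curve_deriv r (of_real \<phi>)) (at (of_real \<phi>))"
        using s_curve_has_field_derivative by (auto intro!: derivative_eq_intros)
      then show "(?z has_vector_derivative s_curve_deriv r (of_real \<phi>)) (at \<phi>)"
        by (rule has_vector_derivative_real_field)
    qed (use \<phi> GZ in auto)
    from vector_derivative_unique_at[OF this has_vector_derivative_real_field[OF GD]]
    have ds: "s_curve_deriv r (of_real \<phi>) = (d - \<i> * of_nat (r + 1) * \<rho> (of_real \<phi>))
        * exp (- \<i> * of_nat (r + 1) * of_real \<phi>)" .
    have "?z \<phi> powi k * s_curve_deriv r (of_real \<phi>) = s_curve_deriv r (of_real \<phi>) / G (of_real \<phi>)"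
      using GZ[OF \<phi>] True by (simp add: field_simps)
    also have "\<dots> = d / \<rho> (of_real \<phi>) - \<i> * of_nat (r + 1)"
      unfolding ds G_def using \<rho>0 by (simp add: field_simps)
    finally have "Im (?z \<phi> powi k * s_curve_deriv r (of_real \<phi>)) = - real (r + 1)"
      using Reals_divide[OF dreal] by (simp add: complex_is_Real_iff)
    moreover have "((\<lambda>\<phi>. - (real (r + 1) * \<phi>)) has_real_derivative - real (r + 1)) (at \<phi>)"
      by (auto intro!: derivative_eq_intros)
    ultimately show ?thesis
      by (simp flip: has_real_derivative_iff_has_vector_derivative)
  qed
  have "((\<lambda>\<phi>. Im (?z \<phi> powi k * s_curve_deriv r (of_real \<phi>)))
     has_integral (- (real (r + 1) * (pi / real (r + 1))) - - (real (r + 1) * 0))) {0..pi / real (r + 1)}"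
    by (rule fundamental_theorem_of_calculus_interior) (use der in \<open>auto intro!: continuous_intros\<close>)
  then show ?thesis using True by simp
qed

end

lemma x_hat_eq_curve:
  assumes "r \<ge> 1" "0 < \<phi>" "\<phi> < pi / real (r + 1)"
  shows "complex_of_real (x_hat r \<phi>)
    = s_curve r (of_real \<phi>) ^ (r + 1) / (s_curve r (of_real \<phi>) - 1) ^ r"
proof -
  note pos = sin_positive[OF assms]
  have s: "s_curve r (of_real \<phi>) = of_real (sin (real (r + 1) * \<phi>) / sin \<phi>) * cis (- (real r * \<phi>))"
    using s_curve_times_sin[of r \<phi>] pos by (simp add: field_simps)
  have z: "s_curve r (of_real \<phi>) - 1 = of_real (sin (real r * \<phi>) / sin \<phi>) * cis (- (real (r + 1) * \<phi>))"
    using z_curve_times_sin[of r \<phi>] pos by (simp add: field_simps)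
  have c: "cis (- (real r * \<phi>)) ^ (r + 1) = cis (- (real (r + 1) * \<phi>)) ^ r"
    unfolding Complex.DeMoivre by (rule arg_cong[of _ _ cis]) (simp add: algebra_simps)
  have "s_curve r (of_real \<phi>) ^ (r + 1) / (s_curve r (of_real \<phi>) - 1) ^ r
      = of_real ((sin (real (r + 1) * \<phi>) / sin \<phi>) ^ (r + 1) / (sin (real r * \<phi>) / sin \<phi>) ^ r)"
    unfolding z unfolding s power_mult_distrib c by simp
  also have "(sin (real (r + 1) * \<phi>) / sin \<phi>) ^ (r + 1) / (sin (real r * \<phi>) / sin \<phi>) ^ r = x_hat r \<phi>"
    using pos by (simp add: x_hat_def power_divide field_simps)
  finally show ?thesis by simp
qed

text \<open>By \<open>s = (s - 1) + 1\<close> and the binomial theorem the integrand is a Laurent polynomial in \<open>s - 1\<close>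
  times \<open>s'\<close>; the exponent \<open>- 1\<close> occurs at most for the indices \<open>r m - 1\<close> and \<open>r m\<close> of the expansion.\<close>

lemma curve_moment_integral:
  assumes r: "r \<ge> 1"
  shows "((\<lambda>\<phi>. Im ((s_curve r (of_real \<phi>) ^ (r + 1) / (s_curve r (of_real \<phi>) - 1) ^ r) ^ m
        * (1 - of_nat r / (s_curve r (of_real \<phi>) - 1)) * s_curve_deriv r (of_real \<phi>)))
     has_integral (real r * pi * (real (((r + 1) * m) choose m) / real (m + 1)))) {0..pi / real (r + 1)}"
proof -
  define N where "N = (r + 1) * m"
  define I where "I = (\<lambda>k::int. if k = -1 then - pi else 0)"
  let ?z = "\<lambda>\<phi>. s_curve r (of_real \<phi>) - 1"
  let ?J = "\<lambda>k \<phi>. Im (?z \<phi> powi k * s_curve_deriv r (of_real \<phi>))"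
  have J: "(?J k has_integral I k) {0..pi / real (r + 1)}" for k
    unfolding I_def by (rule power_curve_integral[OF r])
  have "((\<lambda>\<phi>. \<Sum>i\<le>N. real (N choose i) * (?J (int i - int (r * m)) \<phi> - real r * ?J (int i - int (r * m) - 1) \<phi>))
      has_integral (\<Sum>i\<le>N. real (N choose i) * (I (int i - int (r * m)) - real r * I (int i - int (r * m) - 1))))
      {0..pi / real (r + 1)}"
    by (intro has_integral_sum has_integral_mult_right has_integral_diff J) simp
  moreover have "(\<Sum>i\<le>N. real (N choose i) * (I (int i - int (r * m)) - real r * I (int i - int (r * m) - 1)))
      = real r * pi * (real (((r + 1) * m) choose m) / real (m + 1))"
  proof -
    have c1: "real (N choose (r * m)) = real (N choose m)"
      using binomial_symmetric[of m N] by (simp add: N_def)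
    have a: "(\<Sum>i\<le>N. real (N choose i) * I (int i - int (r * m) - 1)) = - pi * real (N choose m)"
    proof -
      have "(\<Sum>i\<le>N. real (N choose i) * I (int i - int (r * m) - 1))
          = (\<Sum>i\<le>N. if i = r * m then - pi * real (N choose m) else 0)"
        by (intro sum.cong refl) (auto simp: I_def c1 simp flip: of_nat_mult)
      also have "\<dots> = - pi * real (N choose m)"
        by (simp add: N_def)
      finally show ?thesis .
    qed
    have b: "(\<Sum>i\<le>N. real (N choose i) * I (int i - int (r * m)))
        = - pi * (real (r * m) * real (N choose m) / real (m + 1))"
    proof (cases "m = 0")
      case True
      then show ?thesis by (simp add: I_def)
    next
      case False
      then obtain b where b: "r * m = Suc b" using r by (cases "r * m") auto
      have N: "N = Suc (m + b)" using b by (simp add: N_def)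
      have "Suc m * (N choose Suc m) = Suc b * (N choose m)"
        unfolding N by (rule Suc_times_binomial_add)
      then have "real (Suc m) * real (N choose Suc m) = real (Suc b) * real (N choose m)"
        by (metis of_nat_mult)
      moreover have "N choose b = N choose Suc m"
        using binomial_symmetric[of b N] by (simp add: N)
      ultimately have c: "real (N choose b) = real (r * m) * real (N choose m) / real (m + 1)"
        unfolding b by (simp add: nonzero_eq_divide_eq mult.commute)
      have "(\<Sum>i\<le>N. real (N choose i) * I (int i - int (r * m)))
          = (\<Sum>i\<le>N. if i = b then - pi * real (N choose b) else 0)"
        unfolding b by (intro sum.cong refl) (auto simp: I_def)
      also have "\<dots> = - pi * real (N choose b)"
        by (simp add: N)
      finally show ?thesis using c by simp
    qed
    have "(\<Sum>i\<le>N. real (N choose i) * (I (int i - int (r * m)) - real r * I (int i - int (r * m) - 1)))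
       = (\<Sum>i\<le>N. real (N choose i) * I (int i - int (r * m)))
         - real r * (\<Sum>i\<le>N. real (N choose i) * I (int i - int (r * m) - 1))"
      by (simp add: right_diff_distrib sum_subtractf sum_distrib_left mult.left_commute)
    also have "\<dots> = real r * pi * (real (N choose m) / real (m + 1))"
      unfolding a b by (simp add: field_simps)
    finally show ?thesis by (simp add: N_def)
  qed
  moreover have "(\<Sum>i\<le>N. real (N choose i) * (?J (int i - int (r * m)) \<phi> - real r * ?J (int i - int (r * m) - 1) \<phi>))
      = Im ((s_curve r (of_real \<phi>) ^ (r + 1) / ?z \<phi> ^ r) ^ m * (1 - of_nat r / ?z \<phi>) * s_curve_deriv r (of_real \<phi>))"
    if "\<phi> \<in> {0..pi / real (r + 1)}" for \<phi>
  proof -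
    define z where "z = ?z \<phi>"
    define d where "d = s_curve_deriv r (of_real \<phi>)"
    have z0: "z \<noteq> 0" using z_curve_nonzero[OF r, of \<phi>] that by (simp add: z_def)
    have "s_curve r (of_real \<phi>) ^ N = (z + 1) ^ N" by (simp add: z_def)
    also have "\<dots> = (\<Sum>i\<le>N. of_nat (N choose i) * z ^ i)"
      by (simp add: binomial_ring)
    finally have bin: "(s_curve r (of_real \<phi>) ^ (r + 1) / z ^ r) ^ m
        = (\<Sum>i\<le>N. of_nat (N choose i) * (z ^ i / z ^ (r * m)))"
      by (simp add: power_divide sum_divide_distrib N_def flip: power_mult del: power_Suc)
    have p1: "z ^ i / z ^ (r * m) = z powi (int i - int (r * m))" for i
      using z0 by (simp add: power_int_diff flip: of_nat_mult)
    have p2: "z powi (k - 1) = z powi k / z" for k using z0 by (simp add: power_int_diff)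
    have "(s_curve r (of_real \<phi>) ^ (r + 1) / z ^ r) ^ m * (1 - of_nat r / z) * d
       = (\<Sum>i\<le>N. of_nat (N choose i) * (z powi (int i - int (r * m)) * d
            - of_nat r * (z powi (int i - int (r * m) - 1) * d)))"
      unfolding bin p1 p2 sum_distrib_right by (intro sum.cong refl) (simp add: algebra_simps)
    also have "Im \<dots> = (\<Sum>i\<le>N. real (N choose i) * (Im (z powi (int i - int (r * m)) * d)
            - real r * Im (z powi (int i - int (r * m) - 1) * d)))"
    proof -
      have n: "Im (of_nat k * w) = real k * Im w" for k w by simp
      show ?thesis unfolding Im_sum n minus_complex.sel ..
    qed
    finally show ?thesis unfolding z_def d_def by simp
  qed
  ultimately show ?thesis
    by (metis (no_types, lifting) has_integral_eq)
qed

lemma inj_on_x_hat: "r \<ge> 1 \<Longrightarrow> inj_on (x_hat r) {0<..<pi / real (r + 1)}"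
  by (rule linorder_inj_onI) (use x_hat_strict_antimono in force)+

lemma x_hat_image:
  assumes r: "r \<ge> 1"
  shows "x_hat r ` {0<..<pi / real (r + 1)} = {0<..<c_edge r}"
proof -
  let ?\<theta> = "pi / real (r + 1)"
  define X where "X = (\<lambda>\<phi>. Re (s_curve r (of_real \<phi>) ^ (r + 1) / (s_curve r (of_real \<phi>) - 1) ^ r))"
  have X: "X \<phi> = x_hat r \<phi>" if "0 < \<phi>" "\<phi> < ?\<theta>" for \<phi>
    unfolding X_def x_hat_eq_curve[OF r that, symmetric] by simp
  have cont: "continuous_on {0..?\<theta>} X"
  proof -
    have "continuous_on UNIV (s_curve r)"
      unfolding s_curve_def[abs_def] by (intro continuous_intros)
    then have "continuous_on {0..?\<theta>} (\<lambda>\<phi>. s_curve r (of_real \<phi>))"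
      by (rule continuous_on_compose2) (auto intro!: continuous_intros)
    then show ?thesis
      unfolding X_def using z_curve_nonzero[OF r] by (intro continuous_intros) auto
  qed
  have X0: "X 0 = c_edge r"
  proof -
    have s: "s_curve r 0 = of_real (real (r + 1))" by (simp add: s_curve_def)
    have "s_curve r 0 - 1 = of_real (real r)" using z_curve_0[OF r] by simp
    then have "X 0 = Re (of_real (real (r + 1)) ^ (r + 1) / of_real (real r) ^ r)"
      unfolding X_def of_real_0 s by simp
    also have "\<dots> = c_edge r"
      unfolding of_real_power[symmetric] of_real_divide[symmetric] Re_complex_of_real c_edge_def ..
    finally show ?thesis .
  qed
  have "s_curve r (of_real ?\<theta>) = 0" using z_curve_end[OF r] by simp
  then have X\<theta>: "X ?\<theta> = 0" by (simp add: X_def)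
  have \<theta>: "0 < ?\<theta>" by simp
  show ?thesis
  proof (intro equalityI subsetI)
    fix t assume "t \<in> x_hat r ` {0<..<?\<theta>}"
    then obtain \<phi> where \<phi>: "0 < \<phi>" "\<phi> < ?\<theta>" "t = x_hat r \<phi>" by auto
    have "0 < t"
      unfolding \<phi>(3) x_hat_def using sin_positive[OF r \<phi>(1,2)] by simp
    moreover have "t < c_edge r"
    proof (rule ccontr)
      assume "\<not> t < c_edge r"
      have half: "0 < \<phi> / 2" "\<phi> / 2 < \<phi>" "\<phi> / 2 < ?\<theta>" using \<phi>(1,2) by linarith+
      have h: "t < X (\<phi> / 2)"
      proof -
        show ?thesis
          using half \<phi>(2) X[of "\<phi> / 2"] x_hat_strict_antimono[OF r, of "\<phi> / 2" \<phi>] by (simp add: \<phi>(3))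
      qed
      define y where "y = (t + X (\<phi> / 2)) / 2"
      have y: "c_edge r < y" "y < X (\<phi> / 2)"
        using h \<open>\<not> t < c_edge r\<close> by (auto simp: y_def field_simps)
      have "\<exists>\<psi>\<ge>0. \<psi> \<le> \<phi> / 2 \<and> X \<psi> = y"
        by (rule IVT') (use y X0 \<phi> in \<open>auto intro!: continuous_on_subset[OF cont]\<close>)
      then obtain \<psi> where \<psi>: "0 \<le> \<psi>" "\<psi> \<le> \<phi> / 2" "X \<psi> = y" by blast
      with y X0 have "\<psi> \<noteq> 0" "\<psi> \<noteq> \<phi> / 2" by auto
      then show False
        using \<psi> y(2) half X[of \<psi>] X[of "\<phi> / 2"] x_hat_strict_antimono[OF r, of \<psi> "\<phi> / 2"] by linarith
    qed
    ultimately show "t \<in> {0<..<c_edge r}" by simp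
  next
    fix t assume t: "t \<in> {0<..<c_edge r}"
    have "\<exists>\<phi>\<ge>0. \<phi> \<le> ?\<theta> \<and> X \<phi> = t"
      by (rule IVT2') (use t X0 X\<theta> \<theta> cont in auto)
    then obtain \<phi> where \<phi>: "0 \<le> \<phi>" "\<phi> \<le> ?\<theta>" "X \<phi> = t" by blast
    with t X0 X\<theta> have "\<phi> \<noteq> 0" "\<phi> \<noteq> ?\<theta>" by auto
    with \<phi> have "0 < \<phi>" "\<phi> < ?\<theta>" by auto
    with \<phi> X show "t \<in> x_hat r ` {0<..<?\<theta>}" by (metis greaterThanLessThan_iff imageI)
  qed
qed

text \<open>Logarithmic differentiation of \<open>s\<^sup>r\<^sup>+\<^sup>1 / (s - 1)\<^sup>r\<close>, multiplied by \<open>s\<close>: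
  \<open>s ((r + 1) / s - r / (s - 1)) = 1 - r / (s - 1)\<close>.\<close>

lemma x_hat_has_derivative:
  assumes r: "r \<ge> 1" and \<phi>: "0 < \<phi>" "\<phi> < pi / real (r + 1)"
  defines "s \<equiv> s_curve r (of_real \<phi>)"
  obtains D where "(x_hat r has_real_derivative D) (at \<phi>)" "D \<le> 0"
    "of_real D * s = of_real (x_hat r \<phi>) * (1 - of_nat r / (s - 1)) * s_curve_deriv r (of_real \<phi>)"
proof -
  let ?S = "{0<..<pi / real (r + 1)}"
  define F where "F = (\<lambda>w. s_curve r w ^ (r + 1) / (s_curve r w - 1) ^ r)"
  define d where "d = s_curve_deriv r (of_real \<phi>)"
  define z where "z = s - 1"
  have FX: "F (of_real x) = of_real (x_hat r x)" if "x \<in> ?S" for x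
    using x_hat_eq_curve[OF r, of x] that by (simp add: F_def)
  have z0: "z \<noteq> 0" unfolding z_def s_def by (rule z_curve_nonzero[OF r]) (use \<phi> in auto)
  define F' where "F' = (of_nat (r + 1) * s ^ r * d * z ^ r - s ^ (r + 1) * (of_nat r * z ^ (r - 1) * d)) / (z ^ r * z ^ r)"
  have F': "(F has_field_derivative F') (at (of_real \<phi>))"
    unfolding F_def F'_def d_def
    by (rule derivative_eq_intros s_curve_has_field_derivative refl | use z0 in \<open>simp add: z_def s_def\<close>)+
  have F's: "F' * s = F (of_real \<phi>) * (1 - of_nat r / z) * d"
  proof -
    have zr: "z ^ r = z ^ (r - 1) * z" using r by (cases r) auto
    have s: "s = z + 1" by (simp add: z_def)
    have F'e: "F' = (of_nat (r + 1) * s ^ r * z - s ^ (r + 1) * of_nat r) * d / (z ^ r * z)"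
      unfolding F'_def using z0 by (simp add: zr field_simps)
    have F\<phi>: "F (of_real \<phi>) = s ^ (r + 1) / z ^ r" by (simp add: F_def z_def s_def)
    have "(of_nat (r + 1) * s ^ r * z - s ^ (r + 1) * of_nat r) * s = s ^ (r + 1) * (z - of_nat r)"
    proof -
      have "(of_nat (r + 1) * s ^ r * z - s ^ (r + 1) * of_nat r) * s
          = s ^ (r + 1) * (of_nat (r + 1) * z - s * of_nat r)" by (simp add: algebra_simps)
      also have "of_nat (r + 1) * z - s * of_nat r = z - of_nat r" by (simp add: s algebra_simps)
      finally show ?thesis .
    qed
    then have "F' * s = s ^ (r + 1) * (z - of_nat r) * d / (z ^ r * z)"
      unfolding F'e by (metis times_divide_eq_left mult.assoc mult.commute)
    moreover have "1 - of_nat r / z = (z - of_nat r) / z"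
      using z0 by (simp add: diff_divide_distrib)
    ultimately show ?thesis using F\<phi> by (simp add: mult_ac)
  qed
  \<comment> \<open>On the interval the values of \<open>F\<close> are real, hence so is its derivative along it.\<close>
  have "((\<lambda>x. Im (F (of_real x))) has_real_derivative Im F') (at \<phi>)"
    by (rule has_real_derivative_Im_Re(1)[OF F'])
  then have "((\<lambda>x. 0) has_real_derivative Im F') (at \<phi>)"
    by (rule has_field_derivative_transform_within_open[where S = ?S]) (use \<phi> FX in auto)
  then have "Im F' = 0" using DERIV_unique DERIV_const by blast
  then have F'R: "F' = of_real (Re F')" by (simp add: complex_eq_iff)
  have "((\<lambda>x. Re (F (of_real x))) has_real_derivative Re F') (at \<phi>)"
    by (rule has_real_derivative_Im_Re(2)[OF F'])
  then have D: "(x_hat r has_real_derivative Re F') (at \<phi>)"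
    by (rule has_field_derivative_transform_within_open[where S = ?S]) (use \<phi> FX in auto)
  show thesis
  proof (rule that[OF D])
    show "Re F' \<le> 0"
    proof (rule ccontr)
      assume "\<not> Re F' \<le> 0"
      then obtain e where e: "e > 0" "\<And>h. h > 0 \<Longrightarrow> h < e \<Longrightarrow> x_hat r \<phi> < x_hat r (\<phi> + h)"
        using DERIV_pos_inc_right[OF D] by auto
      define T where "T = pi / real (r + 1)"
      have T: "\<phi> < T" using \<phi> by (simp add: T_def)
      define h where "h = min (e / 2) ((T - \<phi>) / 2)"
      have h1: "h \<le> e / 2" unfolding h_def by (rule min.cobounded1)
      have h2: "h \<le> (T - \<phi>) / 2" unfolding h_def by (rule min.cobounded2)
      have "0 < h" unfolding h_def using e(1) T by simp
      moreover have "h < e" using h1 e(1) by linarith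
      moreover have "\<phi> + h < T" using h2 T by argo
      ultimately have h: "h > 0" "h < e" "\<phi> + h < T" .
      show False using e(2)[OF h(1,2)] x_hat_strict_antimono[OF r \<phi>(1), of "\<phi> + h"] h by (simp add: T_def)
    qed
    show "of_real (Re F') * s = of_real (x_hat r \<phi>) * (1 - of_nat r / (s - 1)) * s_curve_deriv r (of_real \<phi>)"
      using F's FX[of \<phi>] \<phi> unfolding F'R[symmetric] z_def d_def by simp
  qed
qed

text \<open>The substitution \<open>t = x_hat r \<phi>\<close>. Since \<open>x_hat \<cdot> u = - Im s / (r \<pi>)\<close>, the transformed integrand is
  the one of \<open>curve_moment_integral\<close> divided by \<open>r \<pi>\<close>; being nonnegative, it is absolutely
  integrable.\<close>

lemma u_density_moment:
  assumes r: "r \<ge> 1"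
  shows "(\<lambda>t. t ^ m * u_density r t) absolutely_integrable_on {0<..<c_edge r}"
    and "integral {0<..<c_edge r} (\<lambda>t. t ^ m * u_density r t)
       = real (((r + 1) * m) choose m) / real (m + 1)"
proof -
  let ?S = "{0<..<pi / real (r + 1)}"
  define x' where "x' = deriv (x_hat r)"
  define w where "w = (\<lambda>\<phi>. Im ((s_curve r (of_real \<phi>) ^ (r + 1) / (s_curve r (of_real \<phi>) - 1) ^ r) ^ m
        * (1 - of_nat r / (s_curve r (of_real \<phi>) - 1)) * s_curve_deriv r (of_real \<phi>)))"
  have x': "(x_hat r has_real_derivative x' \<phi>) (at \<phi>)" if "\<phi> \<in> ?S" for \<phi>
    using x_hat_has_derivative[OF r, of \<phi>] that by (metis DERIV_imp_deriv greaterThanLessThan_iff x'_def)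
  have eq: "\<bar>x' \<phi>\<bar> * (x_hat r \<phi> ^ m * u_density r (x_hat r \<phi>)) = w \<phi> / (real r * pi)"
    if "\<phi> \<in> ?S" for \<phi>
  proof -
    have \<phi>: "0 < \<phi>" "\<phi> < pi / real (r + 1)" using that by auto
    note pos = sin_positive[OF r \<phi>]
    let ?s = "s_curve r (of_real \<phi>)" and ?x = "x_hat r \<phi>"
    let ?q = "(1 - of_nat r / (?s - 1)) * s_curve_deriv r (of_real \<phi>)"
    obtain D where D: "(x_hat r has_real_derivative D) (at \<phi>)" "D \<le> 0"
        and Ds: "of_real D * ?s = of_real ?x * ?q"
      using x_hat_has_derivative[OF r \<phi>] by (metis mult.assoc)
    have xpos: "?x > 0" unfolding x_hat_def using pos by simp
    have "x' \<phi> = D" using D(1) x'[OF that] DERIV_unique by blast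
    then have "\<bar>x' \<phi>\<bar> = - D" using D(2) by simp
    have "w \<phi> = Im (of_real (?x ^ m) * ?q)"
      unfolding w_def x_hat_eq_curve[OF r \<phi>, symmetric] by (simp add: mult.assoc)
    then have w: "w \<phi> = ?x ^ m * Im ?q" by simp
    have "D * Im ?s = ?x * Im ?q" using arg_cong[OF Ds, of Im] by simp
    then have q: "Im ?q = D * Im ?s / ?x" using xpos by (simp add: field_simps)
    have "?s = of_real (sin (real (r + 1) * \<phi>) / sin \<phi>) * cis (- (real r * \<phi>))"
      using s_curve_times_sin[of r \<phi>] pos by (simp add: field_simps)
    then have Ims: "Im ?s = - (sin (real (r + 1) * \<phi>) * sin (real r * \<phi>) / sin \<phi>)" by simp
    have "u_density r ?x * (real r * pi) * ?x = - Im ?s"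
    proof -
      have "1 / (real r * pi) * (A ^ (r + 1) / B ^ r) * (real r * pi) * (B ^ (r + 1) / (C * A ^ r)) = B * A / C"
        if "A > 0" "B > 0" "C > 0" for A B C :: real
        using that r by (simp add: field_simps)
      from this[OF pos(2,3,1)] show ?thesis
        unfolding u_density_x_hat[OF r \<phi>] Ims unfolding x_hat_def by (simp only: minus_minus)
    qed
    then have "u_density r ?x = - Im ?s / ?x / (real r * pi)" using xpos r by (simp add: field_simps)
    then show ?thesis unfolding w q \<open>\<bar>x' \<phi>\<bar> = - D\<close> by (simp add: field_simps)
  qed
  define c where "c = real (((r + 1) * m) choose m) / real (m + 1)"
  have "(w has_integral (real r * pi * c)) {0..pi / real (r + 1)}"
    unfolding w_def c_def by (rule curve_moment_integral[OF r])
  then have "((\<lambda>\<phi>. w \<phi> / (real r * pi)) has_integral (real r * pi * c / (real r * pi))) ?S"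
    by (intro has_integral_divide) (simp add: has_integral_Icc_iff_Ioo)
  then have wI: "((\<lambda>\<phi>. w \<phi> / (real r * pi)) has_integral c) ?S"
    using r by simp
  have I: "((\<lambda>\<phi>. \<bar>x' \<phi>\<bar> * (x_hat r \<phi> ^ m * u_density r (x_hat r \<phi>))) has_integral c) ?S"
    using has_integral_eq[OF _ wI] eq by (metis (no_types, lifting))
  have nonneg: "0 \<le> \<bar>x' \<phi>\<bar> * (x_hat r \<phi> ^ m * u_density r (x_hat r \<phi>))" if "\<phi> \<in> ?S" for \<phi>
  proof -
    have "0 < x_hat r \<phi>" "0 < u_density r (x_hat r \<phi>)"
      using sin_positive[OF r, of \<phi>] that u_density_x_hat[OF r, of \<phi>] r by (auto simp: x_hat_def)
    then show ?thesis by simp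
  qed
  have abs: "(\<lambda>\<phi>. \<bar>x' \<phi>\<bar> * (x_hat r \<phi> ^ m * u_density r (x_hat r \<phi>))) absolutely_integrable_on ?S"
    by (rule nonnegative_absolutely_integrable_1) (use I nonneg in \<open>auto intro: has_integral_integrable\<close>)
  have "(\<lambda>\<phi>. \<bar>x' \<phi>\<bar> * (x_hat r \<phi> ^ m * u_density r (x_hat r \<phi>))) absolutely_integrable_on ?S \<and>
      integral ?S (\<lambda>\<phi>. \<bar>x' \<phi>\<bar> * (x_hat r \<phi> ^ m * u_density r (x_hat r \<phi>))) = c"
    using abs I by (simp add: integral_unique)
  then have "(\<lambda>t. t ^ m * u_density r t) absolutely_integrable_on (x_hat r ` ?S) \<and>
      integral (x_hat r ` ?S) (\<lambda>t. t ^ m * u_density r t) = c"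
    by (subst has_absolute_integral_change_of_variables_1'[symmetric, where g' = x'])
       (use x' inj_on_x_hat[OF r] in \<open>auto intro: has_field_derivative_at_within\<close>)
  then show "(\<lambda>t. t ^ m * u_density r t) absolutely_integrable_on {0<..<c_edge r}"
    "integral {0<..<c_edge r} (\<lambda>t. t ^ m * u_density r t) = real (((r + 1) * m) choose m) / real (m + 1)"
    unfolding x_hat_image[OF r] c_def by auto
qed

section \<open>The moments of the zeros\<close>

lemma multiple_laguerre_eq_prod:
  assumes "inj_on x {1..r * n}"
    and "x ` {1..r * n} = {t. poly (multiple_laguerre r (\<lambda>j. n) \<alpha>) t = 0}"
  shows "multiple_laguerre r (\<lambda>j. n) \<alpha> = (\<Prod>k\<in>{1..r * n}. [:- x k, 1:])"
proof (rule poly_eqI_degree_lead_coeff[where A = "x ` {1..r * n}" and n = "r * n"])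
  show "coeff (multiple_laguerre r (\<lambda>j. n) \<alpha>) (r * n) = coeff (\<Prod>k\<in>{1..r * n}. [:- x k, 1:]) (r * n)"
    using multiple_laguerre_monic(2)[where r = r and n = "\<lambda>j. n" and \<alpha> = \<alpha>] coeff_prod_linear[of x "{1..r * n}"]
    by simp
  show "r * n \<le> card (x ` {1..r * n})" using assms(1) by (simp add: card_image)
  show "degree (multiple_laguerre r (\<lambda>j. n) \<alpha>) \<le> r * n"
    using multiple_laguerre_monic(1)[where r = r and n = "\<lambda>j. n" and \<alpha> = \<alpha>] by simp
  show "degree (\<Prod>k\<in>{1..r * n}. [:- x k, 1:]) \<le> r * n"
    by (simp add: degree_prod_linear)
  fix t assume "t \<in> x ` {1..r * n}"
  then show "poly (multiple_laguerre r (\<lambda>j. n) \<alpha>) t = poly (\<Prod>k\<in>{1..r * n}. [:- x k, 1:]) t"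
    using assms(2) by (auto simp: poly_prod prod_zero_iff)
qed

lemma rev_fps_laguerre:
  assumes "multiple_laguerre r (\<lambda>j. n) \<alpha> = (\<Prod>k\<in>{1..r * n}. [:- x k, 1:])"
  shows "rev_fps h (r * n) (fold lag_step (laguerre_shifts (\<lambda>j. n) \<alpha> r) 1)
       = (\<Prod>k\<in>{1..r * n}. 1 - fps_const (h * x k) * fps_X)"
proof -
  have "fold lag_step (laguerre_shifts (\<lambda>j. n) \<alpha> r) 1
      = smult ((-1) ^ (r * n)) (multiple_laguerre r (\<lambda>j. n) \<alpha>)"
    by (simp add: multiple_laguerre_eq flip: power_add)
  then show ?thesis
    using rev_fps_prod_linear[of "{1..r * n}" h x] by (simp add: assms)
qed

text \<open>All parameters of the \<open>r n\<close> operators lie in \<open>[0, n + a]\<close>, so a barrier started at a suitable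
  multiple of \<open>n\<close> ends at a multiple of \<open>n\<close>.\<close>

lemma zeros_linear_bound:
  assumes L: "multiple_laguerre r (\<lambda>j. n) \<alpha> = (\<Prod>k\<in>{1..r * n}. [:- x k, 1:])"
    and pos: "\<And>k. k \<in> {1..r * n} \<Longrightarrow> 0 < x k"
    and n: "n \<ge> 1" and \<alpha>: "\<And>j. j \<in> {1..r} \<Longrightarrow> -1 < \<alpha> j \<and> \<alpha> j \<le> a" and a: "a \<ge> 0"
    and k: "k \<in> {1..r * n}"
  shows "x k \<le> (2 + 2 * a + 6 * real r) * real n"
proof -
  define N where "N = r * n"
  define bs where "bs = laguerre_shifts (\<lambda>j. n) \<alpha> r"
  define R where "R = (\<Prod>k\<in>{1..N}. 1 - fps_const (x k) * fps_X)"
  define B where "B = real n + a"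
  \<comment> \<open>The starting point \<open>2 (B + 2 N)\<close> demanded by the barrier argument, moved by \<open>2\<close> in each of \<open>N\<close> steps.\<close>
  define b where "b = 2 * (B + 2 * real N) + 2 * real N"
  have len: "length bs = N" by (simp add: bs_def length_laguerre_shifts N_def)
  have "rev_fps 1 (0 + length bs) (fold lag_step bs 1) = rev_steps 1 0 bs (rev_fps 1 0 1)"
    by (rule rev_fps_fold_lag_step) simp
  moreover have "rev_fps 1 0 1 = 1" by (rule fps_ext) (simp add: rev_fps_def)
  moreover have "rev_fps 1 N (fold lag_step bs 1) = R"
    using rev_fps_laguerre[OF L, of 1] by (simp add: R_def N_def bs_def)
  ultimately have R: "R = rev_steps 1 0 bs 1"
    by (simp add: len)
  have bsB: "0 \<le> \<beta> \<and> \<beta> \<le> B" if \<beta>: "\<beta> \<in> set bs" for \<beta>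
  proof -
    obtain j i where "j \<in> {1..r}" "i < n" "\<beta> = \<alpha> j + real n - real i"
      using \<beta> by (fastforce simp: bs_def laguerre_shifts_def simp del: upt_Suc)
    then show ?thesis using \<alpha>[of j] by (auto simp: B_def)
  qed
  have B: "B > 0" using n a by (simp add: B_def)
  have "barrier (0 + length bs) (2 * (B + 2 * real N) + 2 * real (length bs)) (rev_steps 1 0 bs 1)"
    by (rule barrier_rev_steps[where B = B]) (use barrier_0 bsB B in \<open>auto simp: len\<close>)
  then have bar: "barrier N b R" by (simp add: len R b_def)
  have b: "b > 0" using B by (simp add: b_def)
  have H: "power_sum_fps N R $ m = (\<Sum>k\<in>{1..N}. x k ^ m)" if "m \<ge> 1" for m
    unfolding power_sum_fps_def R_def log_deriv_prod_linear[OF finite_atLeastAtMost]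
    using that by (cases m) (simp_all add: sum_negf)
  have "x k ^ m / b ^ m \<le> 2 * real N" if m: "m \<ge> 1" for m
  proof -
    have "x k ^ m \<le> (\<Sum>k\<in>{1..N}. x k ^ m)"
      by (rule member_le_sum) (use k pos in \<open>auto simp: N_def less_imp_le\<close>)
    then have "x k ^ m / b ^ m \<le> power_sum_fps N R $ m * (1 / b) ^ m"
      unfolding H[OF m] power_one_over using b by (simp add: divide_right_mono)
    also have "\<dots> \<le> psum m (1 / b) (power_sum_fps N R)"
      unfolding psum_def
      by (rule member_le_sum[of m "{..m}"]) (use bar b in \<open>auto simp: barrier_def\<close>)
    also have "\<dots> \<le> 2 * real N" using bar by (simp add: barrier_def)
    finally show ?thesis .
  qed
  then have "x k \<le> b"
    by (rule bounded_powers_imp_le[OF b less_imp_le[OF pos[OF k]]])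
  also have "b \<le> (2 + 2 * a + 6 * real r) * real n"
  proof -
    have "a * 1 \<le> a * real n" using a n by (intro mult_left_mono) auto
    then show ?thesis by (simp add: b_def B_def N_def algebra_simps)
  qed
  finally show ?thesis .
qed

text \<open>Both sides of \<open>laguerre_identity\<close> are divided by the reversed polynomial: the left-hand side,
  with \<open>r + 1\<close> bounded parameters, differs from \<open>E\<^sub>n\<^sup>r\<^sup>+\<^sup>1\<close> by a null sequence, and the right-hand side, with \<open>r\<close> parameters
  close to \<open>n\<close>, does so from \<open>(E\<^sub>n - y)\<^sup>r\<close>.\<close>

lemma scaled_moments_limit:
  fixes x :: "nat \<Rightarrow> nat \<Rightarrow> real"
  assumes r: "r \<ge> 1"
    and L: "\<And>n. n \<ge> 1 \<Longrightarrow> multiple_laguerre r (\<lambda>j. n) \<alpha> = (\<Prod>k\<in>{1..r * n}. [:- x n k, 1:])"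
    and x: "\<And>n k. n \<ge> 1 \<Longrightarrow> k \<in> {1..r * n} \<Longrightarrow> 0 < x n k \<and> x n k \<le> C * real n"
  shows "(\<lambda>n. 1 / real (r * n) * (\<Sum>k=1..r * n. (x n k / real n) ^ m))
    \<longlonglongrightarrow> real (((r + 1) * m) choose m) / real (m + 1)"
proof -
  \<comment> \<open>The index is shifted by one, since \<open>L\<close> and \<open>x\<close> concern only \<open>n \<ge> 1\<close>.\<close>
  define h where "h = (\<lambda>n. 1 / real (Suc n))"
  define N where "N = (\<lambda>n. r * Suc n)"
  define P where "P = (\<lambda>n. fold lag_step (laguerre_shifts (\<lambda>j. Suc n) \<alpha> r) 1)"
  define R where "R = (\<lambda>n. \<Prod>k\<in>{1..N n}. 1 - fps_const (h n * x (Suc n) k) * fps_X)"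
  define E where "E = (\<lambda>n. log_deriv_fps (h n) (N n) (R n))"
  have h: "h \<longlonglongrightarrow> 0" unfolding h_def using LIMSEQ_inverse_real_of_nat by (simp add: inverse_eq_divide)
  have R0: "R n $ 0 = 1" for n
  proof -
    have "(\<Prod>k\<in>A. 1 - fps_const (h n * x (Suc n) k) * fps_X) $ 0 = 1" for A
      by (induction A rule: infinite_finite_induct) simp_all
    then show ?thesis by (simp add: R_def)
  qed
  have RP: "rev_fps (h n) (N n) (P n) = R n" for n
    unfolding N_def P_def R_def by (rule rev_fps_laguerre) (rule L, simp)
  have degP: "degree (P n) \<le> N n" for n
    unfolding P_def N_def
    using degree_fold_lag_step[of 1 0 "laguerre_shifts (\<lambda>j. Suc n) \<alpha> r"]
    by (simp add: length_laguerre_shifts)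
  have E0: "E n $ 0 = 1" for n
    by (simp add: E_def log_deriv_fps_def mult.assoc)
  have ES: "E n $ Suc j = - (h n * (\<Sum>k=1..N n. (h n * x (Suc n) k) ^ j))" for n j
    unfolding E_def log_deriv_fps_def R_def log_deriv_prod_linear[OF finite_atLeastAtMost]
    by (cases j) (simp_all add: mult.assoc fps_X_power_mult_nth fps_one_def sum_negf)
  have C: "C \<ge> 0" using x[of 1 1] r by simp
  have E: "coeff_bdd E"
    unfolding coeff_bdd_def
  proof
    fix k
    show "Bseq (\<lambda>n. E n $ k)"
    proof (cases k)
      case (Suc j)
      show ?thesis
      proof (rule BseqI'[where K = "real r * C ^ j"])
        fix n
        have hx: "0 \<le> h n * x (Suc n) k \<and> h n * x (Suc n) k \<le> C" if "k \<in> {1..N n}" for k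
          using x[of "Suc n" k] that by (simp add: h_def N_def field_simps del: of_nat_Suc)
        have "\<bar>\<Sum>k=1..N n. (h n * x (Suc n) k) ^ j\<bar> \<le> (\<Sum>k=1..N n. C ^ j)"
          by (rule sum_abs[THEN order_trans], rule sum_mono)
             (use hx in \<open>auto simp: power_abs abs_of_nonneg intro!: power_mono\<close>)
        then have "h n * \<bar>\<Sum>k=1..N n. (h n * x (Suc n) k) ^ j\<bar> \<le> h n * (real (N n) * C ^ j)"
          by (intro mult_left_mono) (auto simp: h_def)
        also have "\<dots> = real r * C ^ j" by (simp add: h_def N_def field_simps)
        finally show "norm (E n $ k) \<le> real r * C ^ j"
          by (simp add: Suc ES abs_mult) (simp add: h_def)
      qed
    qed (simp add: E0)
  qed
  define b1 where "b1 = map (\<lambda>j (n::nat). \<alpha> j) [1..<Suc r] @ [\<lambda>n. 0]"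
  define b2 where "b2 = map (\<lambda>j (n::nat). \<alpha> j + real (Suc n) + 1) [1..<Suc r]"
  have len: "length b1 = Suc r" "length b2 = r" by (simp_all add: b1_def b2_def)
  have "\<exists>V. (\<forall>n. rev_steps (h n) (N n + 0) (map (\<lambda>b. b n) b1) (R n * 1) = R n * V n) \<and>
        coeff_null (\<lambda>n. V n - (log_deriv_fps (h n) (N n) (R n) - fps_const 0 * fps_X) ^ length b1 * 1)"
  proof (rule rev_steps_asymptotic[OF h R0])
    fix b assume "b \<in> set b1"
    then obtain c where "b = (\<lambda>n. c)" by (auto simp: b1_def)
    then show "(\<lambda>n. h n * b n) \<longlonglongrightarrow> 0" using tendsto_mult[OF h tendsto_const[of c]] by simp
  qed (use E in \<open>simp_all add: E_def coeff_bdd_const\<close>)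
  then obtain V where V: "\<And>n. rev_steps (h n) (N n) (map (\<lambda>b. b n) b1) (R n) = R n * V n"
      and Vn: "coeff_null (\<lambda>n. V n - E n ^ Suc r)"
    by (auto simp: E_def len simp del: power_Suc)
  have "\<exists>V. (\<forall>n. rev_steps (h n) (N n + 0) (map (\<lambda>b. b n) b2) (R n * 1) = R n * V n) \<and>
        coeff_null (\<lambda>n. V n - (log_deriv_fps (h n) (N n) (R n) - fps_const 1 * fps_X) ^ length b2 * 1)"
  proof (rule rev_steps_asymptotic[OF h R0])
    fix b assume "b \<in> set b2"
    then obtain c where "b = (\<lambda>n. c + real (Suc n) + 1)" by (auto simp: b2_def)
    then have "(\<lambda>n. h n * b n) = (\<lambda>n. h n * (c + 1) + 1)"
      by (auto simp: h_def field_simps)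
    then show "(\<lambda>n. h n * b n) \<longlonglongrightarrow> 1"
      using tendsto_add[OF tendsto_mult[OF h tendsto_const[of "c + 1"]] tendsto_const[of 1]] by simp
  qed (use E in \<open>simp_all add: E_def coeff_bdd_const\<close>)
  then obtain W where W: "\<And>n. rev_steps (h n) (N n) (map (\<lambda>b. b n) b2) (R n) = R n * W n"
      and Wn: "coeff_null (\<lambda>n. W n - (E n - fps_X) ^ r)"
    by (auto simp: E_def len)
  have VW: "V n = W n" for n
  proof -
    let ?b1 = "map (\<lambda>b. b n) b1" and ?b2 = "map (\<lambda>b. b n) b2"
    have l: "length ?b1 = Suc r" "length ?b2 = r" by (simp_all add: b1_def b2_def)
    have e: "?b1 = map \<alpha> [1..<Suc r] @ [0]" "?b2 = map (\<lambda>j. \<alpha> j + real (Suc n) + 1) [1..<Suc r]"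
      by (simp_all add: b1_def b2_def)
    have id: "fold lag_step ?b1 (P n) = - pCons 0 (fold lag_step ?b2 (P n))"
      unfolding e P_def by (rule laguerre_identity)
    have "R n * V n = rev_fps (h n) (N n + length ?b1) (fold lag_step ?b1 (P n))"
      unfolding V[symmetric] rev_fps_fold_lag_step[OF degP] RP ..
    also have "\<dots> = rev_fps (h n) (Suc (N n + length ?b2)) (- pCons 0 (fold lag_step ?b2 (P n)))"
      unfolding id l by simp
    also have "\<dots> = R n * W n"
      unfolding rev_fps_uminus_pCons rev_fps_fold_lag_step[OF degP] RP W ..
    finally have "R n * V n = R n * W n" .
    moreover have "R n \<noteq> 0" using R0[of n] by auto
    ultimately show ?thesis by simp
  qed
  have "coeff_null (\<lambda>n. (W n - (E n - fps_X) ^ r) - (V n - E n ^ Suc r))"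
    by (intro coeff_null_diff Vn Wn)
  then have "coeff_null (\<lambda>n. E n ^ Suc r - (E n - fps_X) ^ r)"
    by (simp add: VW)
  then have "coeff_null (\<lambda>n. E n - limit_fps r)"
    by (rule algebraic_equation_stable[OF E E0 limit_fps_0 limit_fps_equation])
  then have "(\<lambda>n. E n $ Suc m - limit_fps r $ Suc m) \<longlonglongrightarrow> 0"
    by (simp add: coeff_null_def)
  then have "(\<lambda>n. E n $ Suc m) \<longlonglongrightarrow> limit_fps r $ Suc m"
    by (simp add: LIM_zero_iff)
  then have "(\<lambda>n. - (1 / real r) * E n $ Suc m) \<longlonglongrightarrow> - (1 / real r) * limit_fps r $ Suc m"
    by (rule tendsto_mult_left)
  moreover have "- (1 / real r) * limit_fps r $ Suc m = real (((r + 1) * m) choose m) / real (m + 1)"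
    unfolding limit_fps_coeff[OF r] using r by simp
  moreover have "- (1 / real r) * E n $ Suc m
      = 1 / real (r * Suc n) * (\<Sum>k=1..r * Suc n. (x (Suc n) k / real (Suc n)) ^ m)" for n
    unfolding ES by (simp add: h_def N_def del: of_nat_Suc mult_Suc_right)
  ultimately have "(\<lambda>n. 1 / real (r * Suc n) * (\<Sum>k=1..r * Suc n. (x (Suc n) k / real (Suc n)) ^ m))
    \<longlonglongrightarrow> real (((r + 1) * m) choose m) / real (m + 1)"
    by simp
  then show ?thesis by (rule LIMSEQ_imp_Suc)
qed

section \<open>Convergence of the zero distribution\<close>

lemma u_density_nonneg:
  assumes "r \<ge> 1" "t \<in> {0<..<c_edge r}"
  shows "0 \<le> u_density r t"
proof -
  from assms obtain \<phi> where "0 < \<phi>" "\<phi> < pi / real (r + 1)" "t = x_hat r \<phi>"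
    unfolding x_hat_image[OF assms(1), symmetric] by auto
  then show ?thesis
    using sin_positive[OF assms(1), of \<phi>] u_density_x_hat[OF assms(1), of \<phi>] by simp
qed

text \<open>The inverse of a continuous injection between intervals is continuous. Continuity supplies the
  Borel measurability that Lebesgue integrals of the density require.\<close>

lemma continuous_on_u_density:
  assumes r: "r \<ge> 1"
  shows "continuous_on {0<..<c_edge r} (u_density r)"
proof -
  let ?S = "{0<..<pi / real (r + 1)}"
  have pos: "sin \<phi> \<noteq> 0" "sin (real r * \<phi>) \<noteq> 0" "sin (real (r + 1) * \<phi>) \<noteq> 0" if "\<phi> \<in> ?S" for \<phi>
    using sin_positive[OF r, of \<phi>] that by auto
  have "continuous_on ?S (x_hat r)"
    unfolding x_hat_def[abs_def] using pos by (intro continuous_intros) auto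
  then obtain g where "homeomorphism ?S (x_hat r ` ?S) (x_hat r) g"
    using homeomorphism_into_1d[OF convex_imp_path_connected _ refl inj_on_x_hat[OF r]] convex_real_interval(8) by blast
  then have g: "\<And>\<phi>. \<phi> \<in> ?S \<Longrightarrow> g (x_hat r \<phi>) = \<phi>" "continuous_on {0<..<c_edge r} g"
    unfolding homeomorphism_def x_hat_image[OF r] by blast+
  have gS: "g t \<in> ?S" "x_hat r (g t) = t" if "t \<in> {0<..<c_edge r}" for t
    using that g(1) unfolding x_hat_image[OF r, symmetric] by auto
  have "continuous_on {0<..<c_edge r}
      (\<lambda>t. 1 / (real r * pi) * (sin (real r * g t) ^ (r + 1) / sin (real (r + 1) * g t) ^ r))"
    using pos(3)[OF gS(1)] by (intro continuous_intros g(2)) auto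
  moreover have "1 / (real r * pi) * (sin (real r * g t) ^ (r + 1) / sin (real (r + 1) * g t) ^ r) = u_density r t"
    if "t \<in> {0<..<c_edge r}" for t
    using u_density_x_hat[OF r, of "g t"] gS[OF that] by (metis greaterThanLessThan_iff)
  ultimately show ?thesis by (rule continuous_on_eq)
qed

lemma set_integrable_mult_u_density:
  assumes r: "r \<ge> 1" and F: "continuous_on {0<..<c_edge r} F"
    and K: "\<And>t. t \<in> {0<..<c_edge r} \<Longrightarrow> \<bar>F t\<bar> \<le> K"
  shows "set_integrable lborel {0<..<c_edge r} (\<lambda>t. F t * u_density r t)"
proof -
  let ?S = "{0<..<c_edge r}"
  have meas: "(\<lambda>t. indicat_real ?S t *\<^sub>R G t) \<in> borel_measurable lborel" if "continuous_on ?S G" for G :: "real \<Rightarrow> real"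
    using borel_measurable_continuous_on_indicator[OF _ that] by simp
  have "u_density r absolutely_integrable_on ?S" using u_density_moment(1)[OF r, of 0] by simp
  then have "integrable (completion lborel) (\<lambda>t. indicat_real ?S t *\<^sub>R u_density r t)"
    by (simp add: set_integrable_def)
  then have u: "integrable lborel (\<lambda>t. indicat_real ?S t *\<^sub>R u_density r t)"
    using integrable_completion[OF meas[OF continuous_on_u_density[OF r]]] by blast
  show ?thesis
    unfolding set_integrable_def
  proof (rule Bochner_Integration.integrable_bound)
    show "integrable lborel (\<lambda>t. K * (indicat_real ?S t *\<^sub>R u_density r t))"
      by (rule integrable_mult_right) (rule u)
    show "(\<lambda>t. indicat_real ?S t *\<^sub>R (F t * u_density r t)) \<in> borel_measurable lborel"
      by (intro meas continuous_intros F continuous_on_u_density[OF r])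
    show "AE t in lborel. norm (indicat_real ?S t *\<^sub>R (F t * u_density r t))
        \<le> norm (K * (indicat_real ?S t *\<^sub>R u_density r t))"
    proof (rule AE_I2)
      fix t
      show "norm (indicat_real ?S t *\<^sub>R (F t * u_density r t)) \<le> norm (K * (indicat_real ?S t *\<^sub>R u_density r t))"
        using K[of t] by (auto simp: abs_mult indicator_def intro!: mult_right_mono)
    qed
  qed
qed

lemma LBINT_Icc_eq_integral_Ioo:
  fixes F :: "real \<Rightarrow> real"
  assumes "a \<le> b" "set_integrable lborel {a<..<b} F"
  shows "(LBINT t:{a..b}. F t) = integral {a<..<b} F"
proof -
  have "(LBINT t:{a..b}. F t) = (LBINT t:{a<..<b}. F t)"
    using interval_integral_Icc[OF assms(1), of F] interval_integral_Ioo[of a b F] assms(1) by simp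
  then show ?thesis using set_borel_integral_eq_integral(2)[OF assms(2)] by simp
qed

theorem theorem1p2:
  fixes r :: nat and \<alpha> :: "nat \<Rightarrow> real" and x :: "nat \<Rightarrow> nat \<Rightarrow> real"
    and f g :: "real \<Rightarrow> real"
  assumes r: "r \<ge> 1"
    and \<alpha>_gt: "\<And>j. j \<in> {1..r} \<Longrightarrow> \<alpha> j > -1"
    and \<alpha>_diff: "\<And>i j. i \<in> {1..r} \<Longrightarrow> j \<in> {1..r} \<Longrightarrow> i \<noteq> j \<Longrightarrow> \<alpha> i - \<alpha> j \<notin> \<int>"
    and zeros: "\<And>n. n \<ge> 1 \<Longrightarrow>
          x n ` {1..r * n} = {t. poly (multiple_laguerre r (\<lambda>j. n) \<alpha>) t = 0}"
    and zeros_pos: "\<And>n k. n \<ge> 1 \<Longrightarrow> k \<in> {1..r * n} \<Longrightarrow> 0 < x n k"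
    and zeros_ordered: "\<And>n. n \<ge> 1 \<Longrightarrow> strict_mono_on {1..r * n} (x n)"
    and f: "continuous_on {0..c_edge r / real r} f"
    and g: "continuous_on {0..} g" "\<And>t. t \<in> {0..c_edge r / real r} \<Longrightarrow> g t = f t"
  shows "(\<lambda>n. 1 / real (r * n) * (\<Sum>k=1..r * n. g (x n k / real (r * n))))
           \<longlonglongrightarrow> (LBINT t:{0..c_edge r}. f (t / real r) * u_density r t)"
proof -
  let ?S = "{0<..<c_edge r}"
  let ?avg = "\<lambda>F n. 1 / real (r * n) * (\<Sum>k=1..r * n. F (x n k / real (r * n)))"
  let ?int = "\<lambda>F. integral ?S (\<lambda>t. F (t / real r) * u_density r t)"
  have L: "multiple_laguerre r (\<lambda>j. n) \<alpha> = (\<Prod>k\<in>{1..r * n}. [:- x n k, 1:])" if "n \<ge> 1" for n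
    using that by (intro multiple_laguerre_eq_prod zeros strict_mono_on_imp_inj_on zeros_ordered)
  define a where "a = (\<Sum>j\<in>{1..r}. \<bar>\<alpha> j\<bar>)"
  define C where "C = 2 + 2 * a + 6 * real r"
  have a0: "a \<ge> 0" by (simp add: a_def sum_nonneg)
  have \<alpha>a: "-1 < \<alpha> j \<and> \<alpha> j \<le> a" if "j \<in> {1..r}" for j
  proof -
    have "\<bar>\<alpha> j\<bar> \<le> a" unfolding a_def using that by (intro member_le_sum) auto
    then show ?thesis using \<alpha>_gt[OF that] by simp
  qed
  have xC: "0 < x n k \<and> x n k \<le> C * real n" if "n \<ge> 1" "k \<in> {1..r * n}" for n k
    using zeros_linear_bound[OF L[OF that(1)] zeros_pos[OF that(1)] that(1) \<alpha>a a0 that(2)] zeros_pos[OF that]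
    by (simp add: C_def)
  have c0: "c_edge r > 0" using r by (simp add: c_edge_def)
  define Mx where "Mx = max (C / real r) (c_edge r / real r)"
  have y: "x n k / real (r * n) \<in> {0..Mx}" if "n \<ge> 1" "k \<in> {1..r * n}" for n k
  proof -
    have "x n k / real (r * n) \<le> C / real r"
      using xC[OF that] r that(1) by (simp add: field_simps)
    then show ?thesis using xC[OF that] by (simp add: Mx_def)
  qed
  have tr: "t / real r \<in> {0..c_edge r / real r}" "t / real r \<in> {0..Mx}" if "t \<in> ?S" for t
  proof -
    show "t / real r \<in> {0..c_edge r / real r}" using that r by (auto intro!: divide_right_mono)
    then show "t / real r \<in> {0..Mx}" by (auto simp: Mx_def)
  qed

  have integrable: "set_integrable lborel ?S (\<lambda>t. F (t / real r) * u_density r t)"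
    if F: "continuous_on {0..Mx} F" for F :: "real \<Rightarrow> real"
  proof -
    have "compact (F ` {0..Mx})" using F by (intro compact_continuous_image) auto
    then obtain K where K: "\<And>s. s \<in> {0..Mx} \<Longrightarrow> \<bar>F s\<bar> \<le> K"
      using compact_imp_bounded[THEN bounded_iff[THEN iffD1]] by fastforce
    show ?thesis
    proof (rule set_integrable_mult_u_density[OF r])
      show "continuous_on ?S (\<lambda>t. F (t / real r))"
        by (rule continuous_on_compose2[OF F]) (use tr(2) r in \<open>auto intro!: continuous_intros\<close>)
      show "\<bar>F (t / real r)\<bar> \<le> K" if "t \<in> ?S" for t
        using K tr(2)[OF that] by blast
    qed
  qed
  have integrable': "(\<lambda>t. F (t / real r) * u_density r t) integrable_on ?S"
    if "continuous_on {0..Mx} F" for F :: "real \<Rightarrow> real"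
    using set_borel_integral_eq_integral(1)[OF integrable[OF that]] .

  have gM: "continuous_on {0..Mx} g" by (rule continuous_on_subset[OF g(1)]) auto

  have poly_limit: "?avg (\<lambda>t. \<Sum>i\<le>d. c i * t ^ i) \<longlonglongrightarrow> ?int (\<lambda>t. \<Sum>i\<le>d. c i * t ^ i)"
    for c :: "nat \<Rightarrow> real" and d
  proof -
    define \<mu> where "\<mu> = (\<lambda>m. real (((r + 1) * m) choose m) / real (m + 1))"
    have "(\<lambda>n. \<Sum>i\<le>d. c i / real r ^ i * (1 / real (r * n) * (\<Sum>k=1..r * n. (x n k / real n) ^ i)))
        \<longlonglongrightarrow> (\<Sum>i\<le>d. c i / real r ^ i * \<mu> i)"
      unfolding \<mu>_def by (intro tendsto_sum tendsto_mult tendsto_const scaled_moments_limit[OF r L xC])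
    moreover have "(\<Sum>i\<le>d. c i / real r ^ i * (1 / real (r * n) * (\<Sum>k=1..r * n. (x n k / real n) ^ i)))
        = ?avg (\<lambda>t. \<Sum>i\<le>d. c i * t ^ i) n" for n
    proof -
      have "?avg (\<lambda>t. \<Sum>i\<le>d. c i * t ^ i) n
          = (\<Sum>i\<le>d. 1 / real (r * n) * (\<Sum>k=1..r * n. c i * (x n k / real (r * n)) ^ i))"
        unfolding sum_distrib_left by (rule sum.swap)
      also have "\<dots> = (\<Sum>i\<le>d. c i / real r ^ i * (1 / real (r * n) * (\<Sum>k=1..r * n. (x n k / real n) ^ i)))"
        by (intro sum.cong refl) (simp add: sum_distrib_left power_divide power_mult_distrib mult_ac)
      finally show ?thesis ..
    qed
    moreover have "?int (\<lambda>t. \<Sum>i\<le>d. c i * t ^ i) = (\<Sum>i\<le>d. c i / real r ^ i * \<mu> i)"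
    proof (rule integral_unique)
      have "((\<lambda>t. t ^ i * u_density r t) has_integral \<mu> i) ?S" for i
        using u_density_moment[OF r, of i] unfolding \<mu>_def
        by (metis has_integral_integral set_lebesgue_integral_eq_integral(1))
      then have "((\<lambda>t. \<Sum>i\<le>d. c i / real r ^ i * (t ^ i * u_density r t)) has_integral
          (\<Sum>i\<le>d. c i / real r ^ i * \<mu> i)) ?S"
        by (intro has_integral_sum has_integral_mult_right) auto
      moreover have "(\<Sum>i\<le>d. c i / real r ^ i * (t ^ i * u_density r t))
          = (\<Sum>i\<le>d. c i * (t / real r) ^ i) * u_density r t" for t
        unfolding sum_distrib_right by (intro sum.cong refl) (simp add: power_divide)
      ultimately show "((\<lambda>t. (\<Sum>i\<le>d. c i * (t / real r) ^ i) * u_density r t) has_integral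
          (\<Sum>i\<le>d. c i / real r ^ i * \<mu> i)) ?S"
        by simp
    qed
    ultimately show ?thesis by simp
  qed

  have "?avg g \<longlonglongrightarrow> ?int g"
  proof (rule LIMSEQ_I)
    fix e :: real assume e: "0 < e"
    obtain p where "real_polynomial_function p" and p: "\<And>t. t \<in> {0..Mx} \<Longrightarrow> \<bar>g t - p t\<bar> < e / 3"
      using Stone_Weierstrass_real_polynomial_function[of "{0..Mx}" g "e / 3"] gM e by auto
    then obtain c d where pc: "p = (\<lambda>t. \<Sum>i\<le>d. c i * t ^ i)"
      using real_polynomial_function_iff_sum by auto
    have pM: "continuous_on {0..Mx} p" unfolding pc by (intro continuous_intros)
    have avg: "\<bar>?avg g n - ?avg p n\<bar> \<le> e / 3" if n: "n \<ge> 1" for n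
    proof -
      have "?avg g n - ?avg p n = 1 / real (r * n) * (\<Sum>k=1..r * n. g (x n k / real (r * n)) - p (x n k / real (r * n)))"
        by (simp add: sum_subtractf right_diff_distrib)
      also have "\<bar>\<dots>\<bar> \<le> 1 / real (r * n) * (\<Sum>k=1..r * n. e / 3)"
        unfolding abs_mult
        by (intro mult_mono order_trans[OF sum_abs] sum_mono) (use p[OF y[OF n]] in \<open>auto intro: less_imp_le\<close>)
      also have "\<dots> = e / 3" using r n by simp
      finally show ?thesis .
    qed
    have int: "\<bar>?int g - ?int p\<bar> \<le> e / 3"
    proof -
      have u: "u_density r integrable_on ?S" "integral ?S (u_density r) = 1"
        using u_density_moment[OF r, of 0] by (auto simp: set_lebesgue_integral_eq_integral(1))
      have "?int g - ?int p = integral ?S (\<lambda>t. g (t / real r) * u_density r t - p (t / real r) * u_density r t)"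
        by (rule integral_diff[symmetric]) (intro integrable' gM pM)+
      also have "norm \<dots> \<le> integral ?S (\<lambda>t. e / 3 * u_density r t)"
      proof (rule integral_norm_bound_integral)
        show "(\<lambda>t. g (t / real r) * u_density r t - p (t / real r) * u_density r t) integrable_on ?S"
          by (intro integrable_diff integrable' gM pM)
        show "(\<lambda>t. e / 3 * u_density r t) integrable_on ?S"
          by (intro integrable_on_mult_right u(1))
        fix t assume t: "t \<in> ?S"
        have "norm (g (t / real r) * u_density r t - p (t / real r) * u_density r t)
            = \<bar>g (t / real r) - p (t / real r)\<bar> * u_density r t"
          using u_density_nonneg[OF r t] by (simp add: abs_mult flip: left_diff_distrib)
        also have "\<dots> \<le> e / 3 * u_density r t"
          by (rule mult_right_mono) (use p[OF tr(2)[OF t]] u_density_nonneg[OF r t] in auto)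
        finally show "norm (g (t / real r) * u_density r t - p (t / real r) * u_density r t) \<le> e / 3 * u_density r t" .
      qed
      also have "\<dots> = e / 3" by (simp add: u(2))
      finally show ?thesis by simp
    qed
    have "?avg p \<longlonglongrightarrow> ?int p" unfolding pc by (rule poly_limit)
    then obtain n0 where n0: "\<And>n. n \<ge> n0 \<Longrightarrow> norm (?avg p n - ?int p) < e / 3"
      using LIMSEQ_D[of "?avg p" "?int p" "e / 3"] e by auto
    have triangle: "\<bar>u - v\<bar> < e" if "\<bar>u - u'\<bar> \<le> e / 3" "\<bar>v - v'\<bar> \<le> e / 3" "\<bar>u' - v'\<bar> < e / 3"
      for u v u' v' :: real
      using that by linarith
    have "norm (?avg g n - ?int g) < e" if "n \<ge> max 1 n0" for n
      unfolding real_norm_def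
      by (rule triangle[OF avg int n0[unfolded real_norm_def]]) (use that in auto)
    then show "\<exists>no. \<forall>n\<ge>no. norm (?avg g n - ?int g) < e" by blast
  qed
  also have "?int g = ?int f"
    by (rule integral_cong) (use tr(1) g(2) in auto)
  also have "?int f = (LBINT t:{0..c_edge r}. f (t / real r) * u_density r t)"
  proof (rule LBINT_Icc_eq_integral_Ioo[symmetric])
    show "set_integrable lborel ?S (\<lambda>t. f (t / real r) * u_density r t)"
      using integrable[OF gM] by (rule set_integrable_cong[THEN iffD1, rotated -1]) (use tr(1) g(2) in auto)
  qed (use c0 in simp)
  finally show ?thesis .
qed

end
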